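(* Let $\tau$ be a generic Euclidean triangle with triangle group $G_\tau=\langle r_1,r_2,r_3\rangle$ (see context). Then $G_\tau$ admits the presentation $$\langle x_1,x_2,x_3 \mid x_1^2,\ x_2^2,\ x_3^2,\ [\,v,\ h_{n,m}^{-1}\,v\,h_{n,m}\,]\ \text{ for } n,m\in\mathbb{Z},\ (n,m)>(0,0)\rangle,$$ where $v=[x_2x_1,x_1x_3]$ and $h_{n,m}=(x_2x_1)^n(x_1x_3)^m$, with the generator $x_i$ corresponding to $r_i$ for $i=1,2,3$.
   Context: A Euclidean triangle $\tau=A_1A_2A_3$ has edges $e_i=A_jA_k$ of length $\ell_i>0$, $\{i,j,k\}=\{1,2,3\}$. It is generic if for some real $k>0$ the numbers $k\ell_1,k\ell_2,k\ell_3$ are algebraically independent over $\mathbb{Q}$. Let $r_i$ be the reflection of the plane across the line containing $e_i$ and $G_\tau=\langle r_1,r_2,r_3\rangle\subset \mathrm{E}(2)$, with products composed left to right ($(x)gh=((x)g)h$). Commutators are $[a,b]=aba^{-1}b^{-1}$. The order on pairs is lexicographic: $(n,m)>(0,0)$ means $n>0$, or $n=0$ and $m>0$. *)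

theory Defs
  imports "HOL-Analysis.Analysis" "HOL-Algebra.Algebra"
begin

definition alg_indep3 :: "real \<Rightarrow> real \<Rightarrow> real \<Rightarrow> bool" where
  "alg_indep3 x y z \<longleftrightarrow>
     (\<forall>(N::nat) (c :: nat \<Rightarrow> nat \<Rightarrow> nat \<Rightarrow> rat).
        (\<exists>a\<le>N. \<exists>b\<le>N. \<exists>d\<le>N. c a b d \<noteq> 0) \<longrightarrow>
        (\<Sum>a\<le>N. \<Sum>b\<le>N. \<Sum>d\<le>N. of_rat (c a b d) * x ^ a * y ^ b * z ^ d) \<noteq> 0)"

text \<open>Triangle A1 A2 A3 with edge e_i = A_j A_k of length l_i; generic means some positive
  rescaling of (l1,l2,l3) is algebraically independent over Q.\<close>
definition generic_triangle :: "complex \<Rightarrow> complex \<Rightarrow> complex \<Rightarrow> bool" where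
  "generic_triangle A1 A2 A3 \<longleftrightarrow>
     (\<exists>k::real. k > 0 \<and> alg_indep3 (k * dist A2 A3) (k * dist A3 A1) (k * dist A1 A2))"

definition line_reflection :: "complex \<Rightarrow> complex \<Rightarrow> complex \<Rightarrow> complex" where
  "line_reflection p q z = p + ((q - p) / cnj (q - p)) * cnj (z - p)"

text \<open>The Euclidean group E(2) as a HOL-Algebra structure, with products composed
  left to right: (x)(g h) = ((x)g)h, i.e. g \<otimes> h = h \<circ> g.\<close>
definition E2 :: "(complex \<Rightarrow> complex) monoid" where
  "E2 = \<lparr> carrier = {f. bij f \<and> (\<forall>x y. dist (f x) (f y) = dist x y)},
          mult = (\<lambda>g h. h \<circ> g),
          one = id \<rparr>"

definition triangle_group :: "complex \<Rightarrow> complex \<Rightarrow> complex \<Rightarrow> (complex \<Rightarrow> complex) monoid" where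
  "triangle_group A1 A2 A3 =
     E2\<lparr> carrier := generate E2 {line_reflection A2 A3, line_reflection A3 A1, line_reflection A1 A2} \<rparr>"

definition commutator :: "('a, 'b) monoid_scheme \<Rightarrow> 'a \<Rightarrow> 'a \<Rightarrow> 'a" where
  "commutator G a b = a \<otimes>\<^bsub>G\<^esub> b \<otimes>\<^bsub>G\<^esub> inv\<^bsub>G\<^esub> a \<otimes>\<^bsub>G\<^esub> inv\<^bsub>G\<^esub> b"

definition rel_v :: "('a, 'b) monoid_scheme \<Rightarrow> 'a \<Rightarrow> 'a \<Rightarrow> 'a \<Rightarrow> 'a" where
  "rel_v G a1 a2 a3 = commutator G (a2 \<otimes>\<^bsub>G\<^esub> a1) (a1 \<otimes>\<^bsub>G\<^esub> a3)"

definition rel_h :: "('a, 'b) monoid_scheme \<Rightarrow> 'a \<Rightarrow> 'a \<Rightarrow> 'a \<Rightarrow> int \<Rightarrow> int \<Rightarrow> 'a" where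
  "rel_h G a1 a2 a3 n m =
     ((a2 \<otimes>\<^bsub>G\<^esub> a1) [^]\<^bsub>G\<^esub> n) \<otimes>\<^bsub>G\<^esub> ((a1 \<otimes>\<^bsub>G\<^esub> a3) [^]\<^bsub>G\<^esub> m)"

definition satisfies_relators :: "('a, 'b) monoid_scheme \<Rightarrow> 'a \<Rightarrow> 'a \<Rightarrow> 'a \<Rightarrow> bool" where
  "satisfies_relators G a1 a2 a3 \<longleftrightarrow>
     a1 \<otimes>\<^bsub>G\<^esub> a1 = \<one>\<^bsub>G\<^esub> \<and> a2 \<otimes>\<^bsub>G\<^esub> a2 = \<one>\<^bsub>G\<^esub> \<and> a3 \<otimes>\<^bsub>G\<^esub> a3 = \<one>\<^bsub>G\<^esub> \<and>
     (\<forall>n m :: int. (n > 0 \<or> (n = 0 \<and> m > 0)) \<longrightarrow>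
        commutator G (rel_v G a1 a2 a3)
          (inv\<^bsub>G\<^esub> (rel_h G a1 a2 a3 n m) \<otimes>\<^bsub>G\<^esub> rel_v G a1 a2 a3 \<otimes>\<^bsub>G\<^esub> rel_h G a1 a2 a3 n m)
        = \<one>\<^bsub>G\<^esub>)"

end

theory Submission
  imports Defs
begin

text \<open>
  Put \<open>P = x2 x1\<close>, \<open>Q = x1 x3\<close>, \<open>V = [P, Q]\<close> and \<open>V(a,b) = Q^a P^b V P^-b Q^-a\<close>. The relators say that
  \<open>V\<close> commutes with \<open>V(a,b)\<close> whenever \<open>(b,a)\<close> is lexicographically negative; conjugating by powers
  of \<open>Q\<close> and \<open>P\<close> one gets that all \<open>V(a,b)\<close> commute, so that every element of a group satisfying
  the relators and generated by the \<open>x_i\<close> is \<open>n Q^a P^b\<close> or \<open>n Q^a P^b x1\<close> with \<open>n\<close> a product of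
  powers of the \<open>V(a,b)\<close>.

  In the plane \<open>P\<close> and \<open>Q\<close> are rotations with multipliers \<open>\<alpha>\<close> and \<open>\<beta>\<close>, and \<open>V(a,b)\<close> is the
  translation by \<open>\<tau> \<alpha>^-b \<beta>^-a\<close> for a fixed \<open>\<tau> \<noteq> 0\<close>. If \<open>\<alpha>\<close> and \<open>\<beta>\<close> are algebraically independent,
  such a normal form is the identity map only if it is trivial. Applied to the subgroup of
  \<open>E(2) \<times> H\<close> generated by the pairs \<open>(r_i, a_i)\<close>, this shows that the subgroup is the graph of a
  homomorphism.

  For the independence, a polynomial relation between \<open>\<alpha>\<close> and \<open>\<beta>\<close> is a relation \<open>A + B w = 0\<close> with
  \<open>A\<close>, \<open>B\<close> rational polynomials in the edge lengths and \<open>w\<close> the purely imaginary square root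
  given by Heron's formula. For a generic triangle it holds identically in the lengths, and
  specialising to real values of \<open>w\<close> makes \<open>(\<alpha>, \<beta>)\<close> run over an open set of real pairs.
\<close>

section \<open>Groups satisfying the relators\<close>

context group begin

lemma inv_mult_cancel_left:
  assumes "x \<in> carrier G" "y \<in> carrier G"
  shows "inv x \<otimes> (x \<otimes> y) = y" "x \<otimes> (inv x \<otimes> y) = y"
  using assms by (simp_all flip: m_assoc)

lemmas word_simps = m_assoc inv_mult_group inv_mult_cancel_left

definition conj_by :: "'a \<Rightarrow> 'a \<Rightarrow> 'a" where
  "conj_by g v = g \<otimes> v \<otimes> inv g"

definition commute :: "'a \<Rightarrow> 'a \<Rightarrow> bool" where
  "commute u v \<longleftrightarrow> u \<otimes> v = v \<otimes> u"

lemma conj_by_closed [simp]: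
  "g \<in> carrier G \<Longrightarrow> v \<in> carrier G \<Longrightarrow> conj_by g v \<in> carrier G"
  by (simp add: conj_by_def)

lemma conj_by_one [simp]: "v \<in> carrier G \<Longrightarrow> conj_by \<one> v = v"
  by (simp add: conj_by_def)

lemma conj_by_mult_left:
  "g \<in> carrier G \<Longrightarrow> h \<in> carrier G \<Longrightarrow> v \<in> carrier G \<Longrightarrow>
     conj_by (g \<otimes> h) v = conj_by g (conj_by h v)"
  by (simp add: conj_by_def word_simps)

lemma conj_by_mult_right:
  "g \<in> carrier G \<Longrightarrow> u \<in> carrier G \<Longrightarrow> v \<in> carrier G \<Longrightarrow>
     conj_by g (u \<otimes> v) = conj_by g u \<otimes> conj_by g v"
  by (simp add: conj_by_def word_simps)

lemma conj_by_inv_right: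
  "g \<in> carrier G \<Longrightarrow> v \<in> carrier G \<Longrightarrow> conj_by g (inv v) = inv (conj_by g v)"
  by (simp add: conj_by_def word_simps)

lemma conj_by_inv_eq_iff:
  assumes "g \<in> carrier G" "u \<in> carrier G" "v \<in> carrier G"
  shows "conj_by (inv g) u = v \<longleftrightarrow> conj_by g v = u"
proof
  assume "conj_by (inv g) u = v"
  hence "conj_by g v = conj_by (g \<otimes> inv g) u"
    using assms by (simp only: conj_by_mult_left inv_closed)
  thus "conj_by g v = u" using assms by simp
next
  assume "conj_by g v = u"
  hence "conj_by (inv g) u = conj_by (inv g \<otimes> g) v"
    using assms by (simp only: conj_by_mult_left inv_closed)
  thus "conj_by (inv g) u = v" using assms by simp
qed

lemma conj_by_inj:
  assumes "conj_by g u = conj_by g v" "g \<in> carrier G" "u \<in> carrier G" "v \<in> carrier G"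
  shows "u = v"
  using assms by (metis conj_by_closed conj_by_inv_eq_iff)

lemma commute_conj_by_iff:
  "g \<in> carrier G \<Longrightarrow> u \<in> carrier G \<Longrightarrow> v \<in> carrier G \<Longrightarrow>
     commute (conj_by g u) (conj_by g v) \<longleftrightarrow> commute u v"
  unfolding commute_def
  by (auto simp flip: conj_by_mult_right dest!: conj_by_inj)

lemma commute_sym: "commute u v \<Longrightarrow> commute v u"
  by (simp add: commute_def)

lemma commute_mult:
  assumes "commute u w" "commute v w" "u \<in> carrier G" "v \<in> carrier G" "w \<in> carrier G"
  shows "commute (u \<otimes> v) w"
  using assms unfolding commute_def by (metis m_assoc)

lemma commute_inv:
  assumes "commute u w" "u \<in> carrier G" "w \<in> carrier G"
  shows "commute (inv u) w"
proof -
  have "inv u \<otimes> (u \<otimes> w) \<otimes> inv u = inv u \<otimes> (w \<otimes> u) \<otimes> inv u"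
    using assms(1) by (simp add: commute_def)
  thus ?thesis using assms(2,3) by (simp add: commute_def word_simps)
qed

lemma conj_by_commute:
  assumes "commute g v" "g \<in> carrier G" "v \<in> carrier G"
  shows "conj_by g v = v"
  using assms by (simp add: conj_by_def commute_def m_assoc)

lemma commutator_eq_one_iff:
  assumes "a \<in> carrier G" "b \<in> carrier G"
  shows "commutator G a b = \<one> \<longleftrightarrow> commute a b"
proof -
  have "commutator G a b = (a \<otimes> b) \<otimes> inv (b \<otimes> a)"
    using assms by (simp add: commutator_def word_simps)
  thus ?thesis using assms
    by (simp add: commute_def inv_solve_right' )
qed

lemma int_pow_Suc:
  assumes "x \<in> carrier G"
  shows "x [^] (i + 1 :: int) = x [^] i \<otimes> x" "x [^] (i + 1 :: int) = x \<otimes> x [^] i"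
  using assms int_pow_mult[of x i 1] int_pow_mult[of x 1 i] by (simp_all add: add.commute)

end

section \<open>All conjugates of the commutator \<open>V\<close> commute\<close>

locale relator_group = group G for G (structure) +
  fixes x1 x2 x3 :: 'a
  assumes gens [simp]: "x1 \<in> carrier G" "x2 \<in> carrier G" "x3 \<in> carrier G"
    and relators: "satisfies_relators G x1 x2 x3"
begin

definition P :: 'a where "P = x2 \<otimes> x1"
definition Q :: 'a where "Q = x1 \<otimes> x3"
definition V :: 'a where "V = commutator G P Q"
definition Vc :: "int \<Rightarrow> int \<Rightarrow> 'a" where "Vc a b = conj_by (Q [^] a) (conj_by (P [^] b) V)"

lemma PQV_closed [simp]: "P \<in> carrier G" "Q \<in> carrier G" "V \<in> carrier G" "Vc a b \<in> carrier G"
  by (simp_all add: P_def Q_def V_def Vc_def commutator_def)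

lemma Vc_00: "Vc 0 0 = V" by (simp add: Vc_def)

lemma conj_Q_pow: "conj_by (Q [^] n) (Vc a b) = Vc (n + a) b"
  by (simp add: Vc_def int_pow_mult conj_by_mult_left)

text \<open>With \<open>n = -b\<close> and \<open>m = -a\<close> the conjugate occurring in a
  relator is \<open>Vc a b\<close>, and the lexicographic condition on \<open>(n, m)\<close> becomes
  the one assumed on \<open>(b, a)\<close>.\<close>

lemma commute_V_Vc:
  assumes "b < 0 \<or> b = 0 \<and> a < 0"
  shows "commute V (Vc a b)"
proof -
  define h where "h = P [^] (-b) \<otimes> Q [^] (-a)"
  have h: "h \<in> carrier G" by (simp add: h_def)
  have "commutator G V (inv h \<otimes> V \<otimes> h) = \<one>"
    using relators assms unfolding satisfies_relators_def rel_v_def rel_h_def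
    by (auto simp: h_def P_def Q_def V_def)
  hence "commute V (inv h \<otimes> V \<otimes> h)"
    using h by (simp add: commutator_eq_one_iff)
  moreover have "inv h \<otimes> V \<otimes> h = Vc a b"
    by (simp add: h_def Vc_def conj_by_def word_simps int_pow_neg)
  ultimately show ?thesis by simp
qed

text \<open>Conjugation by a power of \<open>Q\<close> moves \<open>V\<close> to
  \<open>Vc s 0\<close> and shifts the first index of the other element; for \<open>d = 0\<close>
  the two elements may be exchanged.\<close>

lemma commute_Vc_0:
  assumes "d \<le> 0"
  shows "commute (Vc s 0) (Vc t d)"
proof -
  have *: "commute (Vc s 0) (Vc t d)" if "d < 0 \<or> d = 0 \<and> t < s" for s t
    using commute_V_Vc[of d "t - s"] that
      commute_conj_by_iff[of "Q [^] s" "Vc 0 0" "Vc (t - s) d"]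
    by (auto simp: conj_Q_pow simp flip: Vc_00)
  show ?thesis
  proof (cases "d < 0 \<or> t < s")
    case True thus ?thesis using *[where s=s and t=t] assms by linarith
  next
    case False
    hence "d = 0" "s < t \<or> s = t" using assms by auto
    thus ?thesis using *[where s = t and t = s] by (auto simp: commute_def)
  qed
qed

text \<open>The commutator of \<open>P\<close> with \<open>Q [^] s\<close>, that is, the correction
  in \<open>P Q^s = W s Q^s P\<close>.\<close>

definition W :: "int \<Rightarrow> 'a" where "W s = P \<otimes> Q [^] s \<otimes> inv P \<otimes> inv (Q [^] s)"

lemma W_closed [simp]: "W s \<in> carrier G" by (simp add: W_def)

lemma W_0: "W 0 = \<one>" by (simp add: W_def)

lemma W_Suc: "W (s + 1) = W s \<otimes> Vc s 0"
  by (simp add: W_def Vc_def conj_by_def V_def commutator_def word_simps int_pow_Suc(1))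

text \<open>Moving \<open>P\<close> to the right past \<open>Q [^] s\<close> leaves
  \<open>W s\<close> on the left and raises the exponent of \<open>P\<close> by one.\<close>

lemma conj_P_Vc: "conj_by P (Vc s b) = conj_by (W s) (Vc s (b + 1))"
  by (simp add: W_def Vc_def conj_by_def word_simps int_pow_Suc(2))

text \<open>By \<open>W_Suc\<close>, \<open>W s\<close> lies in the subgroup generated by the
  \<open>Vc i 0\<close>. The conjugator \<open>g\<close> serves a later application with
  \<open>g = inv P\<close>.\<close>

lemma commute_conj_W:
  assumes "\<And>i. commute (conj_by g (Vc i 0)) y" "g \<in> carrier G" "y \<in> carrier G"
  shows "commute (conj_by g (W s)) y"
proof (induction s rule: int_induct[where k = 0])
  case base
  show ?case using assms by (simp add: W_0 commute_def conj_by_def)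
next
  case (step1 i)
  show ?case using assms step1 by (simp add: W_Suc conj_by_mult_right commute_mult)
next
  case (step2 i)
  have "W (i - 1) = W i \<otimes> inv (Vc (i - 1) 0)"
    using W_Suc[of "i - 1"] by (simp add: inv_solve_right)
  thus ?case using assms step2
    by (simp add: conj_by_mult_right conj_by_inv_right commute_mult commute_inv)
qed

lemma commute_W:
  assumes "\<And>i. commute (Vc i 0) y" "y \<in> carrier G"
  shows "commute (W s) y"
  using commute_conj_W[of \<one> y s] assms by simp

text \<open>Since \<open>b + 1 \<le> 0\<close>, every factor of \<open>W s\<close> commutes with
  \<open>Vc s (b + 1)\<close>, so the correction disappears.\<close>

lemma conj_P_Vc_neg: "b < 0 \<Longrightarrow> conj_by P (Vc s b) = Vc s (b + 1)"
  unfolding conj_P_Vc by (rule conj_by_commute) (auto intro!: commute_W commute_Vc_0)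

text \<open>Conjugation by \<open>P\<close> raises both second indices at once; it is repeated until
  one of them is 0, where \<open>commute_Vc_0\<close> applies. \<open>k\<close> bounds the number of
  repetitions.\<close>

lemma commute_Vc_nonpos:
  assumes "- int k \<le> b" "b \<le> 0" "- int k \<le> d" "d \<le> 0"
  shows "commute (Vc s b) (Vc t d)"
  using assms
proof (induction k arbitrary: b d)
  case 0
  thus ?case using commute_Vc_0[of 0] by auto
next
  case (Suc k)
  consider "b = 0" | "d = 0" | "b < 0" "d < 0" using Suc.prems by linarith
  thus ?case
  proof cases
    case 1 thus ?thesis using commute_Vc_0[of d] Suc.prems by auto
  next
    case 2 thus ?thesis using commute_Vc_0[of b] Suc.prems by (auto intro: commute_sym)
  next
    case 3
    have "commute (Vc s (b + 1)) (Vc t (d + 1))"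
      using Suc.prems 3 by (intro Suc.IH) auto
    thus ?thesis using 3 commute_conj_by_iff[of P "Vc s b" "Vc t d"]
      by (simp add: conj_P_Vc_neg)
  qed
qed

text \<open>Here \<open>W s\<close> lies in the \<open>P\<close>-conjugate of the subgroup generated by the \<open>Vc i (-1)\<close>, so it
  already commutes with the \<open>P\<close>-conjugate of every \<open>Vc s b\<close> covered by the induction hypothesis.\<close>

lemma commute_Vc_le:
  assumes "b \<le> int k" "d \<le> int k"
  shows "commute (Vc s b) (Vc t d)"
  using assms
proof (induction k arbitrary: b d s t)
  case 0
  thus ?case by (intro commute_Vc_nonpos[where k = "nat (max (-b) (-d))"]) auto
next
  case (Suc k)
  have up: "conj_by P (Vc s (b - 1)) = Vc s b" if "b \<le> int (Suc k)" for s b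
  proof -
    have 1: "conj_by (inv P) (Vc i 0) = Vc i (-1)" for i
      by (simp add: conj_by_inv_eq_iff conj_P_Vc_neg)
    have "commute (conj_by (inv P) (W s)) (Vc s (b - 1))"
      using that by (intro commute_conj_W) (auto simp: 1 intro!: Suc.IH)
    hence "commute (conj_by P (conj_by (inv P) (W s))) (conj_by P (Vc s (b - 1)))"
      by (simp add: commute_conj_by_iff)
    moreover have "conj_by P (conj_by (inv P) (W s)) = W s"
      using conj_by_inv_eq_iff[of P "W s" "conj_by (inv P) (W s)"] by simp
    ultimately have "commute (W s) (conj_by (W s) (Vc s b))"
      using conj_P_Vc[of s "b - 1"] by simp
    \<comment> \<open>Rewriting \<open>W s\<close> as its own conjugate exhibits both elements as
      conjugates by \<open>W s\<close>, which can then be stripped.\<close>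
    moreover have "W s = conj_by (W s) (W s)" by (simp add: conj_by_def m_assoc)
    ultimately have "commute (W s) (Vc s b)"
      using commute_conj_by_iff[of "W s" "W s" "Vc s b"] by simp
    thus ?thesis using conj_P_Vc[of s "b - 1"] by (simp add: conj_by_commute)
  qed
  have "commute (Vc s (b - 1)) (Vc t (d - 1))"
    using Suc.prems by (intro Suc.IH) auto
  thus ?case using Suc.prems commute_conj_by_iff[of P "Vc s (b - 1)" "Vc t (d - 1)"]
    by (simp add: up)
qed

lemma commute_Vc: "commute (Vc s b) (Vc t d)"
  by (rule commute_Vc_le[where k = "nat (max b d)"]) auto

lemma conj_P: "conj_by P (Vc a b) = Vc a (b + 1)"
  unfolding conj_P_Vc by (intro conj_by_commute commute_W commute_Vc) auto

lemma conj_P_pow: "conj_by (P [^] n) (Vc a b) = Vc a (n + b)"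
proof (induction n rule: int_induct[where k = 0])
  case (step1 i)
  thus ?case by (simp add: int_pow_Suc(2) conj_by_mult_left conj_P) (simp add: add_ac)
next
  case (step2 i)
  have "conj_by P (conj_by (P [^] (i - 1)) (Vc a b)) = Vc a (i + b)"
    using step2 int_pow_Suc(2)[of P "i - 1"] by (simp flip: conj_by_mult_left)
  also have "\<dots> = conj_by P (Vc a (i - 1 + b))" by (simp add: conj_P algebra_simps)
  finally show ?case by (rule conj_by_inj) auto
qed simp

section \<open>Conjugation by the involution \<open>x1\<close>\<close>

lemma involutions: "x1 \<otimes> x1 = \<one>" "x2 \<otimes> x2 = \<one>" "x3 \<otimes> x3 = \<one>"
  using relators by (auto simp: satisfies_relators_def)

lemma inv_gens: "inv x1 = x1" "inv x2 = x2" "inv x3 = x3"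
  using involutions by (simp_all add: inv_equality)

lemma conj_x1: "conj_by x1 P = inv P" "conj_by x1 Q = inv Q"
  by (simp_all add: conj_by_def P_def Q_def inv_mult_group inv_gens m_assoc involutions)
    (simp add: involutions flip: m_assoc)

lemma conj_x1_pow:
  "conj_by x1 (P [^] n) = P [^] (- n)" "conj_by x1 (Q [^] n) = Q [^] (- n)" for n :: int
proof -
  have *: "conj_by x1 (u [^] n) = conj_by x1 u [^] n" if "u \<in> carrier G" for u and n :: int
  proof (induction n rule: int_induct[where k = 0])
    case base
    show ?case by (simp add: conj_by_def)
  next
    case (step1 i)
    thus ?case using that by (simp add: int_pow_Suc(1) conj_by_mult_right)
  next
    case (step2 i)
    thus ?case using that by (simp add: int_pow_diff conj_by_mult_right conj_by_inv_right)
  qed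
  show "conj_by x1 (P [^] n) = P [^] (- n)" "conj_by x1 (Q [^] n) = Q [^] (- n)"
    by (simp_all add: * conj_x1 int_pow_inv int_pow_neg)
qed

text \<open>Inverting \<open>P\<close> and \<open>Q\<close> turns \<open>V\<close> into
  \<open>P^-1 Q^-1 P Q = P^-1 Q^-1 V Q P\<close>, that is \<open>Vc (-1) (-1)\<close>; hence the
  offset -1 next to the change of sign.\<close>

lemma conj_x1_Vc: "conj_by x1 (Vc a b) = Vc (- a - 1) (- b - 1)"
proof -
  have "conj_by x1 V = conj_by (inv P) (conj_by (inv Q) V)"
    by (simp add: V_def commutator_def conj_by_mult_right conj_by_inv_right conj_x1)
      (simp add: conj_by_def word_simps)
  also have "\<dots> = conj_by (P [^] (- 1 :: int)) (conj_by (Q [^] (- 1 :: int)) V)"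
    by (simp add: int_pow_neg)
  finally have V: "conj_by x1 V = Vc (- 1) (- 1)"
    by (simp only: conj_Q_pow conj_P_pow flip: Vc_00) simp
  have "conj_by x1 (conj_by g v) = conj_by (conj_by x1 g) (conj_by x1 v)"
    if "g \<in> carrier G" "v \<in> carrier G" for g v
    using that by (simp add: conj_by_def word_simps)
  thus ?thesis unfolding Vc_def[of a b]
    by (simp add: conj_x1_pow V conj_P_pow conj_Q_pow)
qed

section \<open>The abelian subgroup generated by the \<open>Vc a b\<close> and the normal
  form\<close>

definition N :: "'a set" where "N = generate G (range (\<lambda>(a, b). Vc a b))"

lemma Vc_in_N: "Vc a b \<in> N"
  unfolding N_def by (rule generate.incl) auto

lemma N_subgroup: "subgroup N G"
  unfolding N_def by (rule generate_is_subgroup) auto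

lemmas N_closed = subgroup.mem_carrier[OF N_subgroup] subgroup.m_closed[OF N_subgroup]
  subgroup.m_inv_closed[OF N_subgroup] subgroup.one_closed[OF N_subgroup]

lemma commute_N:
  assumes "n \<in> N" "m \<in> N"
  shows "commute n m"
proof -
  \<comment> \<open>This is applied twice: with a generator as \<open>y\<close>, then with an
    arbitrary element of \<open>N\<close>.\<close>
  have 1: "commute n y" if "y \<in> carrier G" "\<And>a b. commute (Vc a b) y" "n \<in> N" for n y
    using that(3) unfolding N_def
  proof (induction rule: generate.induct)
    case one
    show ?case using that by (simp add: commute_def)
  next
    case (eng h1 h2)
    thus ?case using that N_closed(1) by (intro commute_mult) (auto simp: N_def)
  qed (use that in \<open>auto intro!: commute_inv\<close>)
  have "commute m (Vc a b)" for a b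
    by (rule 1[OF _ _ assms(2)]) (auto intro: commute_Vc)
  thus ?thesis using N_closed(1)[OF assms(2)]
    by (intro 1[OF _ _ assms(1)]) (simp_all add: commute_sym)
qed

lemma conj_N:
  assumes "g \<in> carrier G" "\<And>a b. conj_by g (Vc a b) \<in> N" "n \<in> N"
  shows "conj_by g n \<in> N"
  using assms(3) unfolding N_def
proof (induction rule: generate.induct)
  case one
  show ?case using assms generate.one by (simp add: conj_by_def)
next
  case (incl h)
  thus ?case using assms by (auto simp: N_def)
next
  case (inv h)
  thus ?case using assms N_closed(3) by (auto simp: N_def conj_by_inv_right)
next
  case (eng h1 h2)
  thus ?case using assms N_closed by (auto simp: N_def conj_by_mult_right)
qed

lemma W_in_N: "W s \<in> N"
proof (induction s rule: int_induct[where k = 0])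
  case base
  show ?case by (simp add: W_0 N_closed)
next
  case (step1 i)
  thus ?case by (simp add: W_Suc N_closed Vc_in_N)
next
  case (step2 i)
  have "W (i - 1) = W i \<otimes> inv (Vc (i - 1) 0)"
    using W_Suc[of "i - 1"] by (simp add: inv_solve_right)
  thus ?case using step2 by (simp add: N_closed Vc_in_N)
qed

definition NF :: "'a set" where
  "NF = {n \<otimes> (Q [^] a \<otimes> P [^] b) \<otimes> e | n (a :: int) (b :: int) e. n \<in> N \<and> e \<in> {\<one>, x1}}"

lemma NF_I: "n \<in> N \<Longrightarrow> e \<in> {\<one>, x1} \<Longrightarrow> n \<otimes> (Q [^] a \<otimes> P [^] b) \<otimes> e \<in> NF" for a b :: int
  unfolding NF_def by blast

text \<open>Passing \<open>n\<close> conjugates it within \<open>N\<close>; passing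
  \<open>Q [^] a\<close> produces \<open>W a\<close>, which is absorbed into the factor from
  \<open>N\<close>.\<close>

lemma NF_mult_P: assumes "g \<in> NF" shows "P \<otimes> g \<in> NF"
proof -
  obtain n a b e where g: "g = n \<otimes> (Q [^] (a::int) \<otimes> P [^] (b::int)) \<otimes> e" "n \<in> N" "e \<in> {\<one>, x1}"
    using assms by (auto simp: NF_def)
  have "P \<otimes> g = (conj_by P n \<otimes> W a) \<otimes> (Q [^] a \<otimes> P [^] (b + 1)) \<otimes> e"
    using g N_closed(1)[OF g(2)] by (auto simp: conj_by_def W_def word_simps int_pow_Suc(2))
  moreover have "conj_by P n \<in> N" by (rule conj_N[OF _ _ g(2)]) (auto simp: conj_P Vc_in_N)
  ultimately show ?thesis using g(3) by (simp add: NF_I N_closed W_in_N del: insert_iff)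
qed

lemma NF_mult_Q: assumes "g \<in> NF" shows "Q \<otimes> g \<in> NF"
proof -
  obtain n a b e where g: "g = n \<otimes> (Q [^] (a::int) \<otimes> P [^] (b::int)) \<otimes> e" "n \<in> N" "e \<in> {\<one>, x1}"
    using assms by (auto simp: NF_def)
  have "Q \<otimes> g = conj_by Q n \<otimes> (Q [^] (a + 1) \<otimes> P [^] b) \<otimes> e"
    using g N_closed(1)[OF g(2)] by (auto simp: conj_by_def word_simps int_pow_Suc(2))
  moreover have "conj_by Q n \<in> N" using conj_Q_pow[of 1]
    by (intro conj_N[OF _ _ g(2)]) (simp_all add: Vc_in_N)
  ultimately show ?thesis using g(3) by (simp add: NF_I del: insert_iff)
qed

text \<open>Passing \<open>x1\<close> to the right conjugates \<open>n\<close> within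
  \<open>N\<close> and negates both exponents; multiplying \<open>e\<close> by \<open>x1\<close>
  exchanges its two values.\<close>

lemma NF_mult_x1: assumes "g \<in> NF" shows "x1 \<otimes> g \<in> NF"
proof -
  obtain n a b e where g: "g = n \<otimes> (Q [^] (a::int) \<otimes> P [^] (b::int)) \<otimes> e" "n \<in> N" "e \<in> {\<one>, x1}"
    using assms by (auto simp: NF_def)
  have "x1 \<otimes> g = conj_by x1 n \<otimes> (conj_by x1 (Q [^] a) \<otimes> conj_by x1 (P [^] b)) \<otimes> (x1 \<otimes> e)"
    using g N_closed(1)[OF g(2)] by (auto simp: conj_by_def word_simps)
  moreover have "conj_by x1 n \<in> N" by (rule conj_N[OF _ _ g(2)]) (auto simp: conj_x1_Vc Vc_in_N)
  moreover have "x1 \<otimes> e \<in> {\<one>, x1}" using g(3) by (auto simp: involutions)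
  ultimately show ?thesis by (simp add: NF_I conj_x1_pow del: insert_iff)
qed

text \<open>\<open>NF\<close> contains the identity and is closed under left multiplication by each
  generator, because \<open>x2 = P x1\<close> and \<open>x3 = x1 Q\<close>; the generators are their
  own inverses.\<close>

lemma generate_subset_NF: "generate G {x1, x2, x3} \<subseteq> NF"
proof
  have carr: "u \<in> carrier G" if "u \<in> generate G {x1, x2, x3}" for u
    by (rule generate_in_carrier[OF _ that]) auto
  have NF_carr: "g \<in> carrier G" if "g \<in> NF" for g
    using that N_closed(1) by (auto simp: NF_def)
  have gen: "x \<otimes> g \<in> NF" if "x \<in> {x1, x2, x3}" "g \<in> NF" for x g
  proof -
    have "x2 = P \<otimes> x1" "x3 = x1 \<otimes> Q"
      by (simp_all add: P_def Q_def involutions m_assoc) (simp add: involutions flip: m_assoc)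
    hence "x2 \<otimes> g = P \<otimes> (x1 \<otimes> g)" "x3 \<otimes> g = x1 \<otimes> (Q \<otimes> g)"
      using NF_carr[OF that(2)] by (metis m_assoc PQV_closed gens)+
    thus ?thesis using that by (auto simp: NF_mult_P NF_mult_Q NF_mult_x1)
  qed
  have mult: "u \<otimes> g \<in> NF" if "u \<in> generate G {x1, x2, x3}" "g \<in> NF" for u g
    using that
  proof (induction arbitrary: g rule: generate.induct)
    case one
    thus ?case using NF_carr by simp
  next
    case (inv h)
    hence "inv h = h" by (auto simp: inv_gens)
    thus ?case using inv gen by simp
  next
    case (eng h1 h2)
    thus ?case using carr NF_carr by (simp add: m_assoc)
  qed (use gen in auto)
  fix u assume u: "u \<in> generate G {x1, x2, x3}"
  have "\<one> \<in> NF" using NF_I[OF N_closed(4), of \<one> 0 0] by simp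
  thus "u \<in> NF" using mult[OF u, of \<one>] carr[OF u] by simp
qed

end

section \<open>Generated subgroups of commutative groups\<close>

lemma (in comm_group) generate_range_finprod:
  assumes "\<And>i. v i \<in> carrier G" "n \<in> generate G (range v)"
  shows "\<exists>S (c :: 'i \<Rightarrow> int). finite S \<and> n = (\<Otimes>i\<in>S. v i [^] c i)"
  using assms(2)
proof (induction rule: generate.induct)
  case one
  show ?case by (rule exI[of _ "{}"]) simp
next
  case (incl h)
  then obtain i where "h = v i" by auto
  thus ?case using assms(1) by (intro exI[of _ "{i}"] exI[of _ "\<lambda>_. 1"]) simp
next
  case (inv h)
  then obtain i where "h = v i" by auto
  thus ?case using assms(1) by (intro exI[of _ "{i}"] exI[of _ "\<lambda>_. -1"]) (simp add: int_pow_neg)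
next
  case (eng h1 h2)
  then obtain S T :: "'i set" and c d where *: "finite S" "h1 = (\<Otimes>i\<in>S. v i [^] (c i :: int))"
    "finite T" "h2 = (\<Otimes>i\<in>T. v i [^] (d i :: int))" by blast
  define c' where "c' i = (if i \<in> S then c i else 0)" for i
  define d' where "d' i = (if i \<in> T then d i else 0)" for i
  have "h1 = (\<Otimes>i\<in>S \<union> T. v i [^] c' i)" unfolding *
    by (rule finprod_mono_neutral_cong_left) (use * assms(1) in \<open>auto simp: c'_def\<close>)
  moreover have "h2 = (\<Otimes>i\<in>S \<union> T. v i [^] d' i)" unfolding *
    by (rule finprod_mono_neutral_cong_left) (use * assms(1) in \<open>auto simp: d'_def\<close>)
  ultimately have "h1 \<otimes> h2 = (\<Otimes>i\<in>S \<union> T. v i [^] (c' i + d' i))"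
    using assms(1) by (simp add: int_pow_mult)
  thus ?case using * by (intro exI[of _ "S \<union> T"] exI[of _ "\<lambda>i. c' i + d' i"]) simp
qed

section \<open>Algebraic independence of the rotation multipliers\<close>

inductive_set rat_poly3 :: "(real \<Rightarrow> real \<Rightarrow> real \<Rightarrow> real) set" where
  zero: "(\<lambda>x y z. 0) \<in> rat_poly3"
| add_term: "F \<in> rat_poly3 \<Longrightarrow> (\<lambda>x y z. F x y z + of_rat q * x ^ a * y ^ b * z ^ d) \<in> rat_poly3"

lemma rat_poly3_monom: "(\<lambda>x y z. of_rat q * x ^ a * y ^ b * z ^ d) \<in> rat_poly3"
  using add_term[OF zero] by simp

lemma rat_poly3_const: "(\<lambda>x y z. of_int n) \<in> rat_poly3"
  using rat_poly3_monom[of "of_int n" 0 0 0] by simp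

lemma rat_poly3_vars:
  "(\<lambda>x y z. x) \<in> rat_poly3" "(\<lambda>x y z. y) \<in> rat_poly3" "(\<lambda>x y z. z) \<in> rat_poly3"
  using rat_poly3_monom[of 1 1 0 0] rat_poly3_monom[of 1 0 1 0] rat_poly3_monom[of 1 0 0 1]
  by simp_all

lemma rat_poly3_add:
  assumes "F \<in> rat_poly3" "H \<in> rat_poly3"
  shows "(\<lambda>x y z. F x y z + H x y z) \<in> rat_poly3"
  using assms(2)
proof induction
  case zero
  thus ?case using assms by simp
next
  case (add_term H q a b d)
  thus ?case using rat_poly3.add_term[of "\<lambda>x y z. F x y z + H x y z" q a b d]
    by (simp add: add.assoc)
qed

lemma rat_poly3_mult:
  assumes "F \<in> rat_poly3" "H \<in> rat_poly3"
  shows "(\<lambda>x y z. F x y z * H x y z) \<in> rat_poly3"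
  using assms(2)
proof induction
  case zero
  thus ?case using rat_poly3.zero by simp
next
  case (add_term H q a b d)
  have "(\<lambda>x y z. F x y z * (of_rat q * x ^ a * y ^ b * z ^ d)) \<in> rat_poly3"
    using assms(1)
  proof induction
    case zero
    thus ?case using rat_poly3.zero by simp
  next
    case (add_term F q' a' b' d')
    have "(\<lambda>x y z. F x y z * (of_rat q * x ^ a * y ^ b * z ^ d)
             + of_rat (q' * q) * x ^ (a' + a) * y ^ (b' + b) * z ^ (d' + d)) \<in> rat_poly3"
      using add_term.IH by (rule rat_poly3.add_term)
    thus ?case by (simp add: power_add of_rat_mult algebra_simps)
  qed
  from rat_poly3_add[OF add_term.IH this] show ?case by (simp add: distrib_left)
qed

lemma rat_poly3_diff:
  assumes "F \<in> rat_poly3" "H \<in> rat_poly3"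
  shows "(\<lambda>x y z. F x y z - H x y z) \<in> rat_poly3"
  using rat_poly3_add[OF assms(1) rat_poly3_mult[OF rat_poly3_const[of "-1"] assms(2)]] by simp

lemma rat_poly3_power:
  assumes "F \<in> rat_poly3"
  shows "(\<lambda>x y z. F x y z ^ n) \<in> rat_poly3"
proof (induction n)
  case 0
  thus ?case using rat_poly3_const[of 1] by simp
next
  case (Suc n)
  thus ?case using rat_poly3_mult[OF assms Suc] by simp
qed

lemmas rat_poly3_intros =
  rat_poly3_const rat_poly3_vars rat_poly3_add rat_poly3_mult rat_poly3_diff rat_poly3_power

text \<open>Links functions built monomial by monomial to the coefficient arrays of
  \<open>alg_indep3\<close>. The expansion is demanded for all large \<open>N\<close>, so that a new
  monomial may raise the bound freely.\<close>

lemma rat_poly3_coeffs: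
  assumes "F \<in> rat_poly3"
  shows "\<exists>c M. \<forall>N\<ge>M. \<forall>x y z.
     F x y z = (\<Sum>a\<le>N. \<Sum>b\<le>N. \<Sum>d\<le>N. of_rat (c a b d) * x ^ a * y ^ b * z ^ d)"
  using assms
proof induction
  case zero
  show ?case by (rule exI[of _ "\<lambda>_ _ _. 0"]) simp
next
  case (add_term F q a b d)
  then obtain c M where c: "\<And>N x y z. N \<ge> M \<Longrightarrow>
     F x y z = (\<Sum>a\<le>N. \<Sum>b\<le>N. \<Sum>d\<le>N. of_rat (c a b d) * x ^ a * y ^ b * z ^ d)" by blast
  define e where "e i j k = (if i = a then if j = b then if k = d then q else 0 else 0 else 0)" for i j k
  have "F x y z + of_rat q * x ^ a * y ^ b * z ^ d
    = (\<Sum>i\<le>N. \<Sum>j\<le>N. \<Sum>k\<le>N. of_rat (c i j k + e i j k) * x ^ i * y ^ j * z ^ k)"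
    if "N \<ge> max M (max a (max b d))" for N x y z
  proof -
    have "of_rat (e i j k) * x ^ i * y ^ j * z ^ k =
      (if i = a then if j = b then if k = d then of_rat q * x ^ a * y ^ b * z ^ d else 0 else 0 else 0)"
      for i j k by (simp add: e_def)
    moreover have "(\<Sum>i\<le>N. \<Sum>j\<le>N. \<Sum>k\<le>N.
      (if i = a then if j = b then if k = d then of_rat q * x ^ a * y ^ b * z ^ d else 0 else 0 else 0))
      = of_rat q * x ^ a * y ^ b * z ^ d"
    proof -
      let ?T = "of_rat q * x ^ a * y ^ b * z ^ d"
      have "(\<Sum>k\<le>N. if i = a then if j = b then if k = d then ?T else 0 else 0 else 0)
        = (if i = a then if j = b then ?T else 0 else 0)" for i j
        using that by (cases "i = a"; cases "j = b") auto
      moreover have "(\<Sum>j\<le>N. if i = a then if j = b then ?T else 0 else 0) = (if i = a then ?T else 0)" for i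
        using that by (cases "i = a") auto
      ultimately show ?thesis using that by simp
    qed
    ultimately have "(\<Sum>i\<le>N. \<Sum>j\<le>N. \<Sum>k\<le>N. of_rat (e i j k) * x ^ i * y ^ j * z ^ k)
      = of_rat q * x ^ a * y ^ b * z ^ d" by simp
    moreover have "M \<le> N" using that by simp
    ultimately show ?thesis
      by (simp add: c[of N] of_rat_add distrib_right sum.distrib)
  qed
  thus ?case
    by (intro exI[of _ "\<lambda>i j k. c i j k + e i j k"] exI[of _ "max M (max a (max b d))"]) simp
qed

text \<open>Independence makes all coefficients zero. A relation at one generic triple thus holds at
  all real arguments, even where no triangle has these edge lengths.\<close>

lemma rat_poly3_identity:
  assumes "alg_indep3 x0 y0 z0" "F \<in> rat_poly3" "F x0 y0 z0 = 0"
  shows "F x y z = 0"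
proof -
  obtain c M where c: "\<And>N x y z. N \<ge> M \<Longrightarrow>
     F x y z = (\<Sum>a\<le>N. \<Sum>b\<le>N. \<Sum>d\<le>N. of_rat (c a b d) * x ^ a * y ^ b * z ^ d)"
    using rat_poly3_coeffs[OF assms(2)] by blast
  have "(\<Sum>a\<le>M. \<Sum>b\<le>M. \<Sum>d\<le>M. of_rat (c a b d) * x0 ^ a * y0 ^ b * z0 ^ d) = 0"
    using assms(3) by (simp flip: c[of M])
  hence "\<not> (\<exists>a\<le>M. \<exists>b\<le>M. \<exists>d\<le>M. c a b d \<noteq> 0)"
    using assms(1)[unfolded alg_indep3_def, rule_format, of M c] by blast
  thus ?thesis by (simp add: c[of M])
qed

text \<open>This is \<open>-16\<close> times the squared area of the triangle with edge lengths \<open>x\<close>, \<open>y\<close>, \<open>z\<close>.\<close>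

definition heron :: "real \<Rightarrow> real \<Rightarrow> real \<Rightarrow> real" where
  "heron x y z = (z\<^sup>2 - x\<^sup>2 - y\<^sup>2)\<^sup>2 - 4 * x\<^sup>2 * y\<^sup>2"

lemma heron_poly: "heron \<in> rat_poly3"
proof -
  have "(\<lambda>x y z. (z\<^sup>2 - x\<^sup>2 - y\<^sup>2)\<^sup>2 - of_int 4 * x\<^sup>2 * y\<^sup>2) \<in> rat_poly3"
    by (intro rat_poly3_intros)
  thus ?thesis by (simp add: heron_def[abs_def])
qed

section \<open>Adjoining a square root of Heron's polynomial\<close>

text \<open>The ring obtained from the rational polynomials by adjoining \<open>w\<close> with
  \<open>w^2 = heron\<close>, viewed as functions: only values on this surface matter, and there
  they have degree at most one in \<open>w\<close>.\<close>

definition quad_ext :: "(real \<Rightarrow> real \<Rightarrow> real \<Rightarrow> complex \<Rightarrow> complex) set" where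
  "quad_ext = {g. \<exists>U\<in>rat_poly3. \<exists>V\<in>rat_poly3. \<forall>x y z w. w\<^sup>2 = of_real (heron x y z) \<longrightarrow>
     g x y z w = of_real (U x y z) + of_real (V x y z) * w}"

lemma quad_ext_base: "U \<in> rat_poly3 \<Longrightarrow> (\<lambda>x y z w. of_real (U x y z)) \<in> quad_ext"
  unfolding quad_ext_def mem_Collect_eq
  by (rule bexI[of _ U], rule bexI[of _ "\<lambda>x y z. 0"]) (auto intro: zero)

lemma quad_ext_const: "(\<lambda>x y z w. of_int n) \<in> quad_ext"
  using quad_ext_base[OF rat_poly3_const[of n]] by simp

lemma quad_ext_root: "(\<lambda>x y z w. w) \<in> quad_ext"
  unfolding quad_ext_def mem_Collect_eq
  by (rule bexI[of _ "\<lambda>x y z. of_int 0"], rule bexI[of _ "\<lambda>x y z. of_int 1"])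
    (simp, (rule rat_poly3_const)+)

lemma quad_ext_add:
  assumes "g \<in> quad_ext" "h \<in> quad_ext"
  shows "(\<lambda>x y z w. g x y z w + h x y z w) \<in> quad_ext"
proof -
  obtain U V where 1: "U \<in> rat_poly3" "V \<in> rat_poly3"
    "\<And>x y z w. w\<^sup>2 = of_real (heron x y z) \<Longrightarrow> g x y z w = of_real (U x y z) + of_real (V x y z) * w"
    using assms(1) by (auto simp: quad_ext_def)
  obtain U' V' where 2: "U' \<in> rat_poly3" "V' \<in> rat_poly3"
    "\<And>x y z w. w\<^sup>2 = of_real (heron x y z) \<Longrightarrow> h x y z w = of_real (U' x y z) + of_real (V' x y z) * w"
    using assms(2) by (auto simp: quad_ext_def)
  show ?thesis unfolding quad_ext_def mem_Collect_eq
  proof (intro bexI allI impI)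
    fix x y z and w :: complex assume "w\<^sup>2 = of_real (heron x y z)"
    thus "g x y z w + h x y z w
      = of_real (U x y z + U' x y z) + of_real (V x y z + V' x y z) * w"
      by (simp add: 1 2 algebra_simps)
  qed (intro rat_poly3_intros 1 2)+
qed

lemma quad_ext_mult:
  assumes "g \<in> quad_ext" "h \<in> quad_ext"
  shows "(\<lambda>x y z w. g x y z w * h x y z w) \<in> quad_ext"
proof -
  obtain U V where 1: "U \<in> rat_poly3" "V \<in> rat_poly3"
    "\<And>x y z w. w\<^sup>2 = of_real (heron x y z) \<Longrightarrow> g x y z w = of_real (U x y z) + of_real (V x y z) * w"
    using assms(1) by (auto simp: quad_ext_def)
  obtain U' V' where 2: "U' \<in> rat_poly3" "V' \<in> rat_poly3"
    "\<And>x y z w. w\<^sup>2 = of_real (heron x y z) \<Longrightarrow> h x y z w = of_real (U' x y z) + of_real (V' x y z) * w"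
    using assms(2) by (auto simp: quad_ext_def)
  show ?thesis unfolding quad_ext_def mem_Collect_eq
  proof (intro bexI allI impI)
    fix x y z and w :: complex assume w: "w\<^sup>2 = of_real (heron x y z)"
    have "(of_real (U x y z) + of_real (V x y z) * w) * (of_real (U' x y z) + of_real (V' x y z) * w)
      = of_real (U x y z * U' x y z) + of_real (V x y z * V' x y z) * w\<^sup>2
        + of_real (U x y z * V' x y z + V x y z * U' x y z) * w"
      by (simp add: algebra_simps power2_eq_square)
    thus "g x y z w * h x y z w
      = of_real (U x y z * U' x y z + V x y z * V' x y z * heron x y z)
        + of_real (U x y z * V' x y z + V x y z * U' x y z) * w"
      using w by (simp add: 1 2)
  qed (intro rat_poly3_intros heron_poly 1 2)+
qed

lemma quad_ext_diff:
  assumes "g \<in> quad_ext" "h \<in> quad_ext"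
  shows "(\<lambda>x y z w. g x y z w - h x y z w) \<in> quad_ext"
  using quad_ext_add[OF assms(1) quad_ext_mult[OF quad_ext_const[of "-1"] assms(2)]] by simp

lemma quad_ext_power:
  assumes "g \<in> quad_ext"
  shows "(\<lambda>x y z w. g x y z w ^ n) \<in> quad_ext"
proof (induction n)
  case 0
  thus ?case using quad_ext_const[of 1] by simp
next
  case (Suc n)
  thus ?case using quad_ext_mult[OF assms Suc] by simp
qed

lemma quad_ext_sum:
  assumes "\<And>i. i \<in> S \<Longrightarrow> g i \<in> quad_ext"
  shows "(\<lambda>x y z w. \<Sum>i\<in>S. g i x y z w) \<in> quad_ext"
  using assms
proof (induction S rule: infinite_finite_induct)
  case (insert i S)
  thus ?case using quad_ext_add[of "g i" "\<lambda>x y z w. \<Sum>i\<in>S. g i x y z w"] by simp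
qed (use quad_ext_const[of 0] in auto)

text \<open>As \<open>w0\<close> is imaginary and \<open>U\<close>, \<open>V\<close> are real,
  comparing real and imaginary parts forces \<open>U = V = 0\<close> at the generic triple, hence
  everywhere. The new root \<open>w\<close> may be real.\<close>

lemma quad_ext_identity:
  assumes "alg_indep3 x0 y0 z0" "w0\<^sup>2 = of_real (heron x0 y0 z0)" "Re w0 = 0" "w0 \<noteq> 0"
    "g \<in> quad_ext" "g x0 y0 z0 w0 = 0" "w\<^sup>2 = of_real (heron x y z)"
  shows "g x y z w = 0"
proof -
  obtain U V where 1: "U \<in> rat_poly3" "V \<in> rat_poly3"
    "\<And>x y z w. w\<^sup>2 = of_real (heron x y z) \<Longrightarrow> g x y z w = of_real (U x y z) + of_real (V x y z) * w"
    using assms(5) by (auto simp: quad_ext_def)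
  have "Im w0 \<noteq> 0" using assms(3,4) by (simp add: complex_eq_iff)
  moreover have "of_real (U x0 y0 z0) + of_real (V x0 y0 z0) * w0 = 0"
    using 1(3)[OF assms(2)] assms(6) by simp
  ultimately have "U x0 y0 z0 = 0" "V x0 y0 z0 = 0"
    using assms(3) by (auto simp: complex_eq_iff)
  hence "U x y z = 0" "V x y z = 0"
    using rat_poly3_identity[OF assms(1)] 1 by blast+
  thus ?thesis using 1(3)[OF assms(7)] by simp
qed

section \<open>Laurent polynomials in one and two variables\<close>

text \<open>Clears denominators: multiplied by \<open>(u * v) ^ M\<close>, a Laurent monomial in
  \<open>u / v\<close> has natural exponents.\<close>

lemma power_mult_power_int:
  fixes u v :: "'a :: field"
  assumes "u \<noteq> 0" "v \<noteq> 0" "\<bar>a\<bar> \<le> int M"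
  shows "u ^ nat (int M + a) * v ^ nat (int M - a) = (u * v) ^ M * (u / v) powi a"
proof -
  have "u ^ nat (int M + a) = u powi (int M + a)" "v ^ nat (int M - a) = v powi (int M - a)"
    using assms by (simp_all add: power_int_def)
  thus ?thesis using assms
    by (simp add: power_int_add power_int_diff power_int_divide_distrib power_mult_distrib)
qed

text \<open>Multiplication by a high power of \<open>x\<close> gives an ordinary polynomial with
  infinitely many roots.\<close>

lemma laurent_coeffs_zero:
  fixes k :: "int \<Rightarrow> 'a :: field_char_0"
  assumes "finite S" "infinite A" "0 \<notin> A" "\<And>x. x \<in> A \<Longrightarrow> (\<Sum>a\<in>S. k a * x powi a) = 0" "a \<in> S"
  shows "k a = 0"
proof -
  obtain M :: nat where M: "\<And>a. a \<in> S \<Longrightarrow> \<bar>a\<bar> \<le> int M"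
  proof
    fix a assume "a \<in> S"
    hence "\<bar>a\<bar> \<le> (\<Sum>a\<in>S. \<bar>a\<bar>)" using assms(1) by (intro member_le_sum) auto
    thus "\<bar>a\<bar> \<le> int (nat (\<Sum>a\<in>S. \<bar>a\<bar>))" by simp
  qed
  define p where "p = (\<Sum>a\<in>S. Polynomial.monom (k a) (nat (int M + a)))"
  have "poly p x = 0" if "x \<in> A" for x
  proof -
    have "x \<noteq> 0" using that assms(3) by auto
    hence "poly p x = x ^ M * (\<Sum>a\<in>S. k a * x powi a)"
      unfolding p_def poly_sum sum_distrib_left
      using M power_mult_power_int[of x 1]
      by (intro sum.cong) (auto simp: poly_monom)
    thus ?thesis using assms(4)[OF that] by simp
  qed
  hence "A \<subseteq> {x. poly p x = 0}" by auto
  hence "p = 0" using assms(2) poly_roots_finite finite_subset by blast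
  hence "0 = Polynomial.coeff p (nat (int M + a))" by simp
  also have "\<dots> = (\<Sum>b\<in>S. if b = a then k b else 0)"
    unfolding p_def coeff_sum
  proof (intro sum.cong refl)
    fix b assume "b \<in> S"
    hence "nat (int M + b) = nat (int M + a) \<longleftrightarrow> b = a"
      using M[of b] M[OF assms(5)] by auto
    thus "Polynomial.coeff (Polynomial.monom (k b) (nat (int M + b))) (nat (int M + a)) = (if b = a then k b else 0)"
      by (simp add: coeff_monom)
  qed
  also have "\<dots> = k a" using assms(1,5) by simp
  finally show ?thesis by simp
qed

text \<open>For fixed \<open>y\<close> the sum is a Laurent polynomial in \<open>x\<close> whose
  coefficients are Laurent polynomials in \<open>y\<close>; the one-variable case applies
  twice.\<close>

lemma laurent2_coeffs_zero:
  fixes k :: "int \<Rightarrow> int \<Rightarrow> 'a :: field_char_0"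
  assumes "finite S" "infinite A" "0 \<notin> A" "infinite B" "0 \<notin> B"
    "\<And>x y. x \<in> A \<Longrightarrow> y \<in> B \<Longrightarrow> (\<Sum>(a, b)\<in>S. k a b * x powi a * y powi b) = 0" "(a, b) \<in> S"
  shows "k a b = 0"
proof -
  define k' where "k' a b = (if (a, b) \<in> S then k a b else 0)" for a b
  have fin: "finite (fst ` S)" "finite (snd ` S)" using assms(1) by auto
  have ab: "a \<in> fst ` S" "b \<in> snd ` S" using imageI[OF assms(7), of fst] imageI[OF assms(7), of snd] by simp_all
  have "(\<Sum>b\<in>snd ` S. k' a b * y powi b) = 0" if y: "y \<in> B" for y
  proof (rule laurent_coeffs_zero[OF fin(1) assms(2,3) _ ab(1)])
    fix x assume x: "x \<in> A"
    have "(\<Sum>a\<in>fst ` S. (\<Sum>b\<in>snd ` S. k' a b * y powi b) * x powi a)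
      = (\<Sum>(a, b)\<in>fst ` S \<times> snd ` S. k' a b * x powi a * y powi b)"
      by (simp add: sum.cartesian_product[symmetric] sum_distrib_right) (simp only: mult_ac)
    also have "\<dots> = (\<Sum>(a, b)\<in>S. k a b * x powi a * y powi b)"
      using fin by (intro sum.mono_neutral_cong_right) (auto simp: k'_def subset_fst_snd)
    finally show "(\<Sum>a\<in>fst ` S. (\<Sum>b\<in>snd ` S. k' a b * y powi b) * x powi a) = 0"
      using assms(6)[OF x y] by simp
  qed
  from laurent_coeffs_zero[OF fin(2) assms(4,5) this ab(2)]
  show ?thesis using assms(7) by (simp add: k'_def)
qed

text \<open>After clearing denominators the relation belongs to \<open>quad_ext\<close>, so it
  spreads from the generic triple to the whole surface, whose real points give enough pairs of
  quotients to kill all coefficients.\<close>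

lemma generic_laurent_independent:
  fixes x0 y0 z0 :: real and w0 :: complex and k :: "int \<Rightarrow> int \<Rightarrow> int"
  defines "c0 \<equiv> complex_of_real (z0\<^sup>2 - x0\<^sup>2 - y0\<^sup>2)" and "d0 \<equiv> complex_of_real (y0\<^sup>2 - x0\<^sup>2 - z0\<^sup>2)"
  assumes "alg_indep3 x0 y0 z0" "w0\<^sup>2 = of_real (heron x0 y0 z0)" "Re w0 = 0"
    and S: "finite S" "(a, b) \<in> S"
    and zero: "(\<Sum>(a, b)\<in>S. of_int (k a b) * ((c0 + w0) / (c0 - w0)) powi a
                  * ((d0 + w0) / (d0 - w0)) powi b) = 0"
  shows "k a b = 0"
proof -
  define c where "c x y z = complex_of_real (z\<^sup>2 - x\<^sup>2 - y\<^sup>2)" for x y z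
  define d where "d x y z = complex_of_real (y\<^sup>2 - x\<^sup>2 - z\<^sup>2)" for x y z
  have cd_ext: "(\<lambda>x y z w. c x y z) \<in> quad_ext" "(\<lambda>x y z w. d x y z) \<in> quad_ext"
    unfolding c_def d_def by (intro quad_ext_base rat_poly3_intros)+
  \<comment> \<open>Heron's polynomial is symmetric in the edges, so both products are free of
    \<open>w\<close>; a denominator can vanish only if an edge does.\<close>
  have prods: "(c x y z + w) * (c x y z - w) = of_real (4 * x\<^sup>2 * y\<^sup>2)"
              "(d x y z + w) * (d x y z - w) = of_real (4 * x\<^sup>2 * z\<^sup>2)"
    if "w\<^sup>2 = of_real (heron x y z)" for x y z w
  proof -
    have "(c x y z + w) * (c x y z - w) = (c x y z)\<^sup>2 - w\<^sup>2"
         "(d x y z + w) * (d x y z - w) = (d x y z)\<^sup>2 - w\<^sup>2"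
      by (simp_all add: algebra_simps power2_eq_square)
    moreover have "heron x y z = (y\<^sup>2 - x\<^sup>2 - z\<^sup>2)\<^sup>2 - 4 * x\<^sup>2 * z\<^sup>2"
      by (simp add: heron_def algebra_simps power2_eq_square)
    hence "complex_of_real (4 * x\<^sup>2 * z\<^sup>2) = of_real ((y\<^sup>2 - x\<^sup>2 - z\<^sup>2)\<^sup>2) - of_real (heron x y z)"
      unfolding of_real_diff[symmetric] of_real_eq_iff by linarith
    moreover have "complex_of_real (4 * x\<^sup>2 * y\<^sup>2) = of_real ((z\<^sup>2 - x\<^sup>2 - y\<^sup>2)\<^sup>2) - of_real (heron x y z)"
      unfolding of_real_diff[symmetric] of_real_eq_iff by (simp add: heron_def)
    ultimately show "(c x y z + w) * (c x y z - w) = of_real (4 * x\<^sup>2 * y\<^sup>2)"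
        "(d x y z + w) * (d x y z - w) = of_real (4 * x\<^sup>2 * z\<^sup>2)"
      unfolding that c_def d_def of_real_power[symmetric] by simp_all
  qed
  obtain M :: nat where M: "\<And>a b. (a, b) \<in> S \<Longrightarrow> \<bar>a\<bar> \<le> int M \<and> \<bar>b\<bar> \<le> int M"
  proof
    fix a b assume "(a, b) \<in> S"
    moreover define T where "T = (\<Sum>i\<in>S. \<bar>fst i\<bar> + \<bar>snd i\<bar>)"
    ultimately have "\<bar>a\<bar> + \<bar>b\<bar> \<le> T"
      using S(1) member_le_sum[of "(a, b)" S "\<lambda>i. \<bar>fst i\<bar> + \<bar>snd i\<bar>"] by simp
    thus "\<bar>a\<bar> \<le> int (nat (\<Sum>i\<in>S. \<bar>fst i\<bar> + \<bar>snd i\<bar>)) \<and> \<bar>b\<bar> \<le> int (nat (\<Sum>i\<in>S. \<bar>fst i\<bar> + \<bar>snd i\<bar>))"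
      unfolding T_def[symmetric] by linarith
  qed
  \<comment> \<open>The relation times the \<open>M\<close>-th powers of both products; all
    exponents are now nonnegative.\<close>
  define g where "g x y z w = (\<Sum>i\<in>S. of_int (k (fst i) (snd i)) *
      ((c x y z + w) ^ nat (int M + fst i) * (c x y z - w) ^ nat (int M - fst i)) *
      ((d x y z + w) ^ nat (int M + snd i) * (d x y z - w) ^ nat (int M - snd i)))" for x y z w
  have g_ext: "g \<in> quad_ext"
    unfolding g_def[abs_def]
    by (intro quad_ext_sum quad_ext_mult quad_ext_power quad_ext_add quad_ext_diff
        quad_ext_const quad_ext_root cd_ext)
  have g_eq: "g x y z w = (of_real (4 * x\<^sup>2 * y\<^sup>2)) ^ M * (of_real (4 * x\<^sup>2 * z\<^sup>2)) ^ M *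
      (\<Sum>(a, b)\<in>S. of_int (k a b) * ((c x y z + w) / (c x y z - w)) powi a
                  * ((d x y z + w) / (d x y z - w)) powi b)"
    if w: "w\<^sup>2 = of_real (heron x y z)" and nz: "x \<noteq> 0" "y \<noteq> 0" "z \<noteq> 0" for x y z w
  proof -
    have "(c x y z + w) * (c x y z - w) \<noteq> 0" "(d x y z + w) * (d x y z - w) \<noteq> 0"
      unfolding prods[OF w] using nz by auto
    hence nz': "c x y z + w \<noteq> 0" "c x y z - w \<noteq> 0" "d x y z + w \<noteq> 0" "d x y z - w \<noteq> 0"
      by auto
    show ?thesis unfolding g_def sum_distrib_left
    proof (intro sum.cong refl)
      fix i assume "i \<in> S"
      hence i: "\<bar>fst i\<bar> \<le> int M" "\<bar>snd i\<bar> \<le> int M" using M[of "fst i" "snd i"] by auto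
      show "of_int (k (fst i) (snd i)) *
          ((c x y z + w) ^ nat (int M + fst i) * (c x y z - w) ^ nat (int M - fst i)) *
          ((d x y z + w) ^ nat (int M + snd i) * (d x y z - w) ^ nat (int M - snd i))
        = (of_real (4 * x\<^sup>2 * y\<^sup>2)) ^ M * (of_real (4 * x\<^sup>2 * z\<^sup>2)) ^ M *
          (case i of (a, b) \<Rightarrow> of_int (k a b) * ((c x y z + w) / (c x y z - w)) powi a
                  * ((d x y z + w) / (d x y z - w)) powi b)"
        unfolding power_mult_power_int[OF nz'(1,2) i(1)] power_mult_power_int[OF nz'(3,4) i(2)]
          prods[OF w] split_beta by (simp only: mult_ac)
    qed
  qed
  \<comment> \<open>The test point \<open>(1, 1, 1)\<close> shows that the edges and
    \<open>heron\<close>, which is -3 there, do not vanish at the generic triple.\<close>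
  have nz0: "F x0 y0 z0 \<noteq> 0" if "F \<in> rat_poly3" "F 1 1 1 \<noteq> 0" for F
  proof
    assume "F x0 y0 z0 = 0"
    hence "F 1 1 1 = 0" by (rule rat_poly3_identity[OF assms(3) that(1)])
    thus False using that(2) by simp
  qed
  have xyz0: "x0 \<noteq> 0" "y0 \<noteq> 0" "z0 \<noteq> 0"
    using nz0[OF rat_poly3_vars(1)] nz0[OF rat_poly3_vars(2)] nz0[OF rat_poly3_vars(3)] by auto
  have "heron x0 y0 z0 \<noteq> 0" using nz0[OF heron_poly] by (simp add: heron_def)
  hence w0: "w0 \<noteq> 0" using assms(4) by auto
  have "g x0 y0 z0 w0 = 0"
    unfolding g_eq[OF assms(4) xyz0] using zero by (simp add: c_def d_def c0_def d0_def)
  note g0 = quad_ext_identity[OF assms(3-5) w0 g_ext this]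
  have vanish: "(\<Sum>(a, b)\<in>S. of_int (k a b) * complex_of_real \<alpha> powi a * complex_of_real \<beta> powi b) = 0"
    if \<alpha>: "\<alpha> \<in> {0<..<1/2}" and \<beta>: "\<beta> \<in> {1<..<2}" for \<alpha> \<beta> :: real
  proof -
    \<comment> \<open>The intervals ensure \<open>\<alpha> > 0\<close> and
      \<open>\<alpha> * \<beta> < 1 < \<beta>\<close>, which makes \<open>r\<close> and
      \<open>s\<close> below positive and hence \<open>y\<close> and \<open>z\<close> real and
      nonzero.\<close>
    have "\<alpha> * \<beta> < 1/2 * 2" using \<alpha> \<beta> by (intro mult_strict_mono) auto
    hence ab: "1 - \<alpha> * \<beta> > 0" by simp
    \<comment> \<open>These solve \<open>s / r = \<alpha>\<close> and \<open>(1 + r) / (1 + s) = \<beta>\<close>, the values of the two quotients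
      at \<open>x = 1\<close>, \<open>y\<^sup>2 = r s\<close>, \<open>z\<^sup>2 = (1 + r) (1 + s)\<close>, \<open>w = s - r\<close>.\<close>
    define r where "r = (\<beta> - 1) / (1 - \<alpha> * \<beta>)"
    define s where "s = \<alpha> * r"
    have r: "r > 0" using ab \<beta> by (simp add: r_def)
    hence s: "s > 0" using \<alpha> by (simp add: s_def)
    have sr: "s / r = \<alpha>" using r by (simp add: s_def)
    have "r * (1 - \<alpha> * \<beta>) = \<beta> - 1" using ab by (simp add: r_def)
    hence "1 + r = \<beta> * (1 + s)" by (simp add: s_def algebra_simps)
    hence rs: "(1 + r) / (1 + s) = \<beta>" using s by (simp add: field_simps)
    define y where "y = sqrt (r * s)"
    define z where "z = sqrt ((1 + r) * (1 + s))"
    define w where "w = complex_of_real (s - r)"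
    have yz: "y\<^sup>2 = r * s" "z\<^sup>2 = (1 + r) * (1 + s)" "y \<noteq> 0" "z \<noteq> 0"
      using r s by (simp_all add: y_def z_def)
    have "heron 1 y z = (s - r)\<^sup>2"
      unfolding heron_def yz by (simp add: power2_eq_square algebra_simps)
    hence w: "w\<^sup>2 = of_real (heron 1 y z)" by (simp add: w_def)
    have "c 1 y z + w = of_real (2 * s)" "c 1 y z - w = of_real (2 * r)"
      "d 1 y z + w = of_real (- 2 * (1 + r))" "d 1 y z - w = of_real (- 2 * (1 + s))"
      unfolding c_def d_def w_def yz of_real_add[symmetric] of_real_diff[symmetric] of_real_eq_iff
      by (simp_all add: algebra_simps)
    moreover have "2 * s / (2 * r) = \<alpha>" "- 2 * (1 + r) / (- 2 * (1 + s)) = \<beta>"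
      using sr rs by (simp_all only: mult_divide_mult_cancel_left_if) auto
    ultimately have frac: "(c 1 y z + w) / (c 1 y z - w) = of_real \<alpha>"
      "(d 1 y z + w) / (d 1 y z - w) = of_real \<beta>"
      by (simp_all only: of_real_divide[symmetric])
    have "g 1 y z w = 0" by (rule g0[OF w])
    thus ?thesis using g_eq[OF w] yz(3,4) unfolding frac by auto
  qed
  have inf: "infinite (complex_of_real ` {u<..<v})" if "u < v" for u v
    using that by (simp add: finite_image_iff inj_on_def infinite_Ioo)
  have "complex_of_int (k a b) = 0"
    by (rule laurent2_coeffs_zero[OF S(1) inf[of 0 "1/2"] _ inf[of 1 2] _ _ S(2)])
      (use vanish in auto)
  thus ?thesis by simp
qed

section \<open>Affine representations of the relators\<close>

definition relator_set :: "('a, 'b) monoid_scheme \<Rightarrow> 'a \<Rightarrow> 'a \<Rightarrow> 'a \<Rightarrow> 'a set" where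
  "relator_set G a1 a2 a3 = {a1 \<otimes>\<^bsub>G\<^esub> a1, a2 \<otimes>\<^bsub>G\<^esub> a2, a3 \<otimes>\<^bsub>G\<^esub> a3} \<union>
     {commutator G (rel_v G a1 a2 a3)
        (inv\<^bsub>G\<^esub> (rel_h G a1 a2 a3 n m) \<otimes>\<^bsub>G\<^esub> rel_v G a1 a2 a3 \<otimes>\<^bsub>G\<^esub> rel_h G a1 a2 a3 n m)
      | n m. n > 0 \<or> n = 0 \<and> m > 0}"

lemma satisfies_relators_iff: "satisfies_relators G a1 a2 a3 \<longleftrightarrow> relator_set G a1 a2 a3 \<subseteq> {\<one>\<^bsub>G\<^esub>}"
  unfolding satisfies_relators_def relator_set_def by auto

lemma (in group) relator_word_closed:
  assumes "a1 \<in> carrier G" "a2 \<in> carrier G" "a3 \<in> carrier G"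
  shows "rel_v G a1 a2 a3 \<in> carrier G" "rel_h G a1 a2 a3 n m \<in> carrier G"
    "relator_set G a1 a2 a3 \<subseteq> carrier G"
  using assms by (auto simp: relator_set_def commutator_def rel_v_def rel_h_def)

lemma (in group_hom) hom_relator_word:
  assumes "a1 \<in> carrier G" "a2 \<in> carrier G" "a3 \<in> carrier G"
  shows "h (rel_v G a1 a2 a3) = rel_v H (h a1) (h a2) (h a3)"
    "h (rel_h G a1 a2 a3 n m) = rel_h H (h a1) (h a2) (h a3) n m"
  using assms by (simp_all add: rel_v_def rel_h_def commutator_def hom_int_pow)

text \<open>The image of a relator is the same word in the images. Used for the two projections of a
  product and for the inclusion of a subgroup.\<close>

lemma (in group_hom) hom_relator_set:
  assumes a: "a1 \<in> carrier G" "a2 \<in> carrier G" "a3 \<in> carrier G"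
    and "x \<in> relator_set G a1 a2 a3" and "satisfies_relators H (h a1) (h a2) (h a3)"
  shows "h x = \<one>\<^bsub>H\<^esub>"
proof -
  note [simp] = G.relator_word_closed[OF a]
  have "h x \<in> relator_set H (h a1) (h a2) (h a3)"
    using assms(4) unfolding relator_set_def
    by (auto simp: a commutator_def hom_relator_word[OF a])
  thus ?thesis using assms(5) by (auto simp: satisfies_relators_iff)
qed

lemma fst_group_hom: "group G \<Longrightarrow> group H \<Longrightarrow> group_hom (G \<times>\<times> H) G fst"
  by (auto simp: group_hom_def group_hom_axioms_def DirProd_group hom_def mult_DirProd')

lemma snd_group_hom: "group G \<Longrightarrow> group H \<Longrightarrow> group_hom (G \<times>\<times> H) H snd"
  by (auto simp: group_hom_def group_hom_axioms_def DirProd_group hom_def mult_DirProd')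

lemma satisfies_relators_DirProd:
  assumes "group G" "group H" "satisfies_relators G a1 a2 a3" "satisfies_relators H b1 b2 b3"
    "a1 \<in> carrier G" "a2 \<in> carrier G" "a3 \<in> carrier G"
    "b1 \<in> carrier H" "b2 \<in> carrier H" "b3 \<in> carrier H"
  shows "satisfies_relators (G \<times>\<times> H) (a1, b1) (a2, b2) (a3, b3)"
  unfolding satisfies_relators_iff
proof
  fix x assume x: "x \<in> relator_set (G \<times>\<times> H) (a1, b1) (a2, b2) (a3, b3)"
  have "fst x = \<one>\<^bsub>G\<^esub>"
    using group_hom.hom_relator_set[OF fst_group_hom[OF assms(1,2)] _ _ _ x] assms by simp
  moreover have "snd x = \<one>\<^bsub>H\<^esub>"
    using group_hom.hom_relator_set[OF snd_group_hom[OF assms(1,2)] _ _ _ x] assms by simp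
  ultimately show "x \<in> {\<one>\<^bsub>G \<times>\<times> H\<^esub>}" by (simp add: prod_eq_iff)
qed

lemma (in group) satisfies_relators_subgroup:
  assumes "subgroup S G" "a1 \<in> S" "a2 \<in> S" "a3 \<in> S" "satisfies_relators G a1 a2 a3"
  shows "satisfies_relators (G\<lparr>carrier := S\<rparr>) a1 a2 a3"
  unfolding satisfies_relators_iff
proof
  have hom: "group_hom (G\<lparr>carrier := S\<rparr>) G id"
    using subgroup.mem_carrier[OF assms(1)] subgroup_imp_group[OF assms(1)]
    by (simp add: group_hom_def group_hom_axioms_def hom_def group_axioms)
  fix x assume "x \<in> relator_set (G\<lparr>carrier := S\<rparr>) a1 a2 a3"
  from group_hom.hom_relator_set[OF hom _ _ _ this] show "x \<in> {\<one>\<^bsub>G\<lparr>carrier := S\<rparr>\<^esub>}"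
    using assms by simp
qed

section \<open>The Euclidean group and its orientation-preserving maps\<close>

lemma E2_simps [simp]:
  "f \<in> carrier E2 \<longleftrightarrow> bij f \<and> (\<forall>x y. dist (f x) (f y) = dist x y)"
  "f \<otimes>\<^bsub>E2\<^esub> g = g \<circ> f" "\<one>\<^bsub>E2\<^esub> = id"
  by (simp_all add: E2_def)

lemma E2_group: "group E2"
proof (rule groupI)
  fix f assume f: "f \<in> carrier E2"
  hence "bij f" by simp
  hence inv: "f (inv_into UNIV f x) = x" for x by (simp add: bij_is_surj surj_f_inv_f)
  have "dist (inv_into UNIV f x) (inv_into UNIV f y) = dist x y" for x y
    using f inv by (metis E2_simps(1))
  moreover have "inv_into UNIV f \<otimes>\<^bsub>E2\<^esub> f = \<one>\<^bsub>E2\<^esub>" using inv by auto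
  ultimately show "\<exists>g\<in>carrier E2. g \<otimes>\<^bsub>E2\<^esub> f = \<one>\<^bsub>E2\<^esub>"
    using \<open>bij f\<close> by (intro bexI[of _ "inv_into UNIV f"]) (simp_all add: bij_imp_bij_inv)
qed (auto simp: bij_comp comp_assoc)

interpretation E2: group E2 by (rule E2_group)

definition aff :: "complex \<Rightarrow> complex \<Rightarrow> complex \<Rightarrow> complex" where
  "aff m t z = m * z + t"

lemma aff_eq_iff: "aff m t = aff m' t' \<longleftrightarrow> m = m' \<and> t = t'"
proof
  assume "aff m t = aff m' t'"
  hence "aff m t 0 = aff m' t' 0" "aff m t 1 = aff m' t' 1" by simp_all
  thus "m = m' \<and> t = t'" by (simp add: aff_def)
qed simp

lemma id_eq_aff: "id = aff 1 0" by (auto simp: aff_def)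

lemma aff_mult: "aff m t \<otimes>\<^bsub>E2\<^esub> aff m' t' = aff (m * m') (m' * t + t')"
  by (auto simp: aff_def fun_eq_iff algebra_simps)

lemma aff_closed:
  assumes "cmod m = 1"
  shows "aff m t \<in> carrier E2"
proof -
  have "m \<noteq> 0" using assms by auto
  hence "bij (aff m t)"
    by (intro o_bij[of "\<lambda>z. (z - t) / m"]) (auto simp: aff_def fun_eq_iff field_simps)
  moreover have "dist (aff m t x) (aff m t y) = dist x y" for x y
    using assms by (simp add: aff_def dist_norm norm_mult flip: right_diff_distrib)
  ultimately show ?thesis by simp
qed

lemma aff_inv:
  assumes "cmod m = 1"
  shows "inv\<^bsub>E2\<^esub> (aff m t) = aff (1 / m) (- t / m)"
proof (rule E2.inv_equality)
  have "m \<noteq> 0" using assms by auto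
  thus "aff (1 / m) (- t / m) \<otimes>\<^bsub>E2\<^esub> aff m t = \<one>\<^bsub>E2\<^esub>"
    unfolding aff_mult by (simp add: id_eq_aff)
qed (use assms in \<open>simp_all only: aff_closed norm_divide norm_one div_by_1\<close>)

lemma aff_pow:
  assumes "cmod m = 1"
  shows "\<exists>t'. aff m t [^]\<^bsub>E2\<^esub> (n :: int) = aff (m powi n) t'"
proof (induction n rule: int_induct[where k = 0])
  case base
  show ?case by (auto simp: id_eq_aff)
next
  case (step1 i)
  have "m \<noteq> 0" using assms by auto
  hence "m powi (i + 1) = m powi i * m" by (simp add: power_int_add)
  then show ?case using step1 assms
    by (auto simp only: E2.int_pow_Suc(1)[OF aff_closed] aff_mult aff_eq_iff)
next
  case (step2 i)
  have "m \<noteq> 0" using assms by auto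
  hence "m powi (i - 1) = m powi i * (1 / m)" by (simp add: power_int_diff)
  then show ?case using step2 assms
    by (auto simp only: E2.int_pow_diff[OF aff_closed] E2.int_pow_1[OF aff_closed] aff_inv aff_mult aff_eq_iff)
qed

text \<open>Products act from left to right, so the translation vector is divided by
  \<open>m\<close>, not multiplied.\<close>

lemma aff_conj:
  assumes "cmod m = 1"
  shows "aff m t \<otimes>\<^bsub>E2\<^esub> aff 1 v \<otimes>\<^bsub>E2\<^esub> inv\<^bsub>E2\<^esub> (aff m t) = aff 1 (v / m)"
proof -
  have "m \<noteq> 0" using assms by auto
  thus ?thesis unfolding aff_inv[OF assms] aff_mult by (simp add: aff_eq_iff field_simps)
qed

lemma aff_commutator:
  assumes "cmod m = 1" "cmod m' = 1"
  shows "commutator E2 (aff m t) (aff m' t') = aff 1 ((m' * t + t' - t - m * t') / (m * m'))"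
proof -
  have "m \<noteq> 0" "m' \<noteq> 0" using assms by auto
  thus ?thesis unfolding commutator_def aff_inv[OF assms(1)] aff_inv[OF assms(2)] aff_mult
    by (simp add: aff_eq_iff field_simps)
qed

lemma translations_commutator: "commutator E2 (aff 1 v) (aff 1 v') = \<one>\<^bsub>E2\<^esub>"
  by (subst aff_commutator) (simp_all add: id_eq_aff)

section \<open>Detecting the identity through an affine representation\<close>

text \<open>To be used with the product of E(2) and an arbitrary group as \<open>G\<close> and the
  first projection as \<open>f\<close>. \<open>f_x1\<close> separates the two values of
  \<open>e\<close> in a normal form, \<open>shift_nz\<close> makes the image of \<open>V\<close> a
  nontrivial translation, and \<open>indep\<close> recovers exponents.\<close>

locale affine_relator_group = group_hom G E2 f + relator_group G x1 x2 x3
  for G :: "('a, 'b) monoid_scheme" (structure) and x1 x2 x3 f +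
  fixes \<alpha> \<beta> s t :: complex
  assumes f_P: "f P = aff \<alpha> s" and f_Q: "f Q = aff \<beta> t" and f_x1: "f x1 \<noteq> aff m v"
    and unit: "cmod \<alpha> = 1" "cmod \<beta> = 1"
    and shift_nz: "\<beta> * s + t - s - \<alpha> * t \<noteq> 0"
    and indep: "\<And>S k a b. finite S \<Longrightarrow> (a, b) \<in> S \<Longrightarrow>
      (\<Sum>(a, b)\<in>S. of_int (k a b) * \<alpha> powi a * \<beta> powi b) = 0 \<Longrightarrow> k a b = (0 :: int)"
begin

definition shift :: complex where "shift = (\<beta> * s + t - s - \<alpha> * t) / (\<alpha> * \<beta>)"

lemma shift_nonzero: "shift \<noteq> 0"
  using shift_nz unit by (auto simp: shift_def)

lemma f_V: "f V = aff 1 shift"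
proof -
  have "f V = commutator E2 (f P) (f Q)"
    by (simp only: V_def commutator_def hom_mult hom_inv PQV_closed G.m_closed G.inv_closed)
  thus ?thesis by (simp add: f_P f_Q aff_commutator unit shift_def del: E2_simps)
qed

lemma cmod_powi: "cmod (\<alpha> powi n) = 1" "cmod (\<beta> powi n) = 1"
  by (simp_all add: norm_power_int unit)

lemma f_P_pow: "\<exists>v. f (P [^] (n :: int)) = aff (\<alpha> powi n) v"
  and f_Q_pow: "\<exists>v. f (Q [^] (n :: int)) = aff (\<beta> powi n) v"
  using aff_pow[OF unit(1)] aff_pow[OF unit(2)] by (simp_all add: hom_int_pow f_P f_Q)

lemma f_conj_by:
  assumes "f g = aff m v" "f u = aff 1 w" "cmod m = 1" "g \<in> carrier G" "u \<in> carrier G"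
  shows "f (G.conj_by g u) = aff 1 (w / m)"
  using assms aff_conj[OF assms(3)] by (simp add: G.conj_by_def del: E2_simps)

lemma f_Vc: "f (Vc a b) = aff 1 (shift * \<alpha> powi (- b) * \<beta> powi (- a))"
proof -
  obtain v v' where v: "f (P [^] b) = aff (\<alpha> powi b) v" "f (Q [^] a) = aff (\<beta> powi a) v'"
    using f_P_pow f_Q_pow by blast
  have "f (Vc a b) = aff 1 (shift / \<alpha> powi b / \<beta> powi a)"
    unfolding Vc_def by (rule f_conj_by[OF v(2) f_conj_by[OF v(1) f_V]]) (auto simp: cmod_powi)
  thus ?thesis by (simp add: power_int_minus divide_inverse)
qed

lemma f_translation_pow:
  assumes "g \<in> carrier G" "f g = aff 1 v"
  shows "f (g [^] (n :: int)) = aff 1 (of_int n * v)"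
proof (induction n rule: int_induct[where k = 0])
  case base
  show ?case by (simp add: id_eq_aff)
next
  case (step1 i)
  thus ?case using assms
    by (simp add: G.int_pow_Suc(1) aff_mult del: E2_simps) (simp add: algebra_simps)
next
  case (step2 i)
  thus ?case using assms
    by (simp add: G.int_pow_diff aff_inv aff_mult del: E2_simps) (simp add: algebra_simps)
qed

text \<open>The exponents of \<open>n\<close> as a word in the commuting \<open>Vc\<close> become
  the coefficients of a Laurent polynomial giving its translation. The last clause lets vanishing
  coefficients be read back in \<open>G\<close>.\<close>

lemma N_finprod:
  assumes "n \<in> N"
  shows "\<exists>S c. finite S \<and>
     f n = aff 1 (shift * (\<Sum>(a, b)\<in>S. of_int (c a b) * \<alpha> powi a * \<beta> powi b)) \<and>
     ((\<forall>(a, b)\<in>S. c a b = (0 :: int)) \<longrightarrow> n = \<one>)"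
proof -
  \<comment> \<open>Swapping and negating the indices makes \<open>v (a, b)\<close> act as the
    translation by \<open>shift * \<alpha> powi a * \<beta> powi b\<close>.\<close>
  define v where "v i = Vc (- snd i) (- fst i)" for i
  have range_v: "range v = range (\<lambda>(a, b). Vc a b)"
  proof
    show "range (\<lambda>(a, b). Vc a b) \<subseteq> range v"
    proof clarify
      fix a b show "Vc a b \<in> range v" by (rule range_eqI[of _ _ "(- b, - a)"]) (simp add: v_def)
    qed
  qed (auto simp: v_def)
  define M where "M = G\<lparr>carrier := N\<rparr>"
  have grpM: "group M" unfolding M_def by (rule G.subgroup_imp_group[OF N_subgroup])
  have "comm_group M"
    by (rule group.group_comm_groupI[OF grpM]) (use commute_N in \<open>auto simp: M_def G.commute_def\<close>)
  then interpret M: comm_group M .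
  have v: "v i \<in> carrier M" for i by (simp add: M_def v_def Vc_in_N)
  have "range v \<subseteq> N" unfolding range_v using Vc_in_N by auto
  hence "generate M (range v) = generate G (range v)"
    unfolding M_def by (rule G.generate_consistent[OF _ N_subgroup])
  also have "\<dots> = N" by (simp only: N_def range_v)
  finally have "n \<in> generate M (range v)" using assms by simp
  from M.generate_range_finprod[OF v this]
  obtain S and c :: "int \<times> int \<Rightarrow> int" where Sc: "finite S" "n = finprod M (\<lambda>i. v i [^]\<^bsub>M\<^esub> c i) S"
    by blast
  have f_fin: "f (finprod M (\<lambda>i. v i [^]\<^bsub>M\<^esub> c i) S)
      = aff 1 (shift * (\<Sum>i\<in>S. of_int (c i) * \<alpha> powi fst i * \<beta> powi snd i))"
    using Sc(1)
  proof induction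
    case empty
    have "\<one>\<^bsub>M\<^esub> = \<one>" by (simp add: M_def)
    thus ?case by (simp add: id_eq_aff)
  next
    case (insert i S)
    let ?p = "finprod M (\<lambda>i. v i [^]\<^bsub>M\<^esub> c i) S"
    have "?p \<in> carrier M" by (rule M.finprod_closed) (simp add: v)
    hence p: "?p \<in> N" by (simp add: M_def)
    have vi: "v i [^]\<^bsub>M\<^esub> c i = v i [^] c i"
      unfolding M_def using G.int_pow_consistent[OF N_subgroup, of "v i" "c i"]
      by (simp add: v_def Vc_in_N)
    have carr: "v i \<in> carrier G" by (simp add: v_def)
    have "finprod M (\<lambda>i. v i [^]\<^bsub>M\<^esub> c i) (insert i S) = v i [^]\<^bsub>M\<^esub> c i \<otimes>\<^bsub>M\<^esub> ?p"
      by (rule M.finprod_insert[OF insert.hyps]) (simp_all add: v)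
    also have "\<dots> = v i [^] c i \<otimes> ?p" unfolding vi by (simp add: M_def)
    finally have ins: "finprod M (\<lambda>i. v i [^]\<^bsub>M\<^esub> c i) (insert i S) = v i [^] c i \<otimes> ?p" .
    have "f (finprod M (\<lambda>i. v i [^]\<^bsub>M\<^esub> c i) (insert i S)) = f (v i [^] c i) \<otimes>\<^bsub>E2\<^esub> f ?p"
      unfolding ins using carr N_closed(1)[OF p] by (simp del: E2_simps)
    also have "f (v i [^] c i) = aff 1 (of_int (c i) * (shift * \<alpha> powi fst i * \<beta> powi snd i))"
      using carr by (rule f_translation_pow) (simp add: v_def f_Vc)
    finally show ?case unfolding insert.IH aff_mult using insert.hyps
      by (simp add: aff_eq_iff algebra_simps)
  qed
  show ?thesis
  proof (intro exI conjI impI)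
    show "finite S" by (rule Sc)
    show "f n = aff 1 (shift * (\<Sum>(a, b)\<in>S. of_int (c (a, b)) * \<alpha> powi a * \<beta> powi b))"
      unfolding Sc f_fin by (simp add: split_beta)
    assume "\<forall>(a, b)\<in>S. c (a, b) = 0"
    hence "finprod M (\<lambda>i. v i [^]\<^bsub>M\<^esub> c i) S = \<one>\<^bsub>M\<^esub>" by (intro M.finprod_one_eqI) auto
    thus "n = \<one>" unfolding Sc by (simp add: M_def)
  qed
qed

text \<open>In a normal form mapped to the identity, \<open>e\<close> is trivial because
  \<open>f x1\<close> is not of the form \<open>aff\<close>; the multiplier then forces
  \<open>a = b = 0\<close>, and the translation part forces all exponents in \<open>n\<close> to
  vanish.\<close>

lemma f_injective:
  assumes "g \<in> generate G {x1, x2, x3}" "f g = id"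
  shows "g = \<one>"
proof -
  obtain n a b e where g: "g = n \<otimes> (Q [^] (a::int) \<otimes> P [^] (b::int)) \<otimes> e" "n \<in> N" "e \<in> {\<one>, x1}"
    using generate_subset_NF assms(1) by (auto simp: NF_def)
  obtain S c where S: "finite S"
     "f n = aff 1 (shift * (\<Sum>(a, b)\<in>S. of_int (c a b) * \<alpha> powi a * \<beta> powi b))"
     "(\<forall>(a, b)\<in>S. c a b = (0 :: int)) \<Longrightarrow> n = \<one>"
    using N_finprod[OF g(2)] by blast
  obtain v v' where v: "f (P [^] b) = aff (\<alpha> powi b) v" "f (Q [^] a) = aff (\<beta> powi a) v'"
    using f_P_pow f_Q_pow by blast
  let ?h = "n \<otimes> (Q [^] a \<otimes> P [^] b)"
  obtain u where u: "f ?h = aff (\<alpha> powi b * \<beta> powi a) u"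
    using N_closed(1)[OF g(2)] S(2) v by (simp add: aff_mult mult.commute del: E2_simps)
  have h: "?h \<in> carrier G" using N_closed(1)[OF g(2)] by simp
  have e1: "e = \<one>"
  proof (rule ccontr)
    assume "e \<noteq> \<one>"
    hence "f ?h \<otimes>\<^bsub>E2\<^esub> f x1 = \<one>\<^bsub>E2\<^esub>"
      using g assms(2) h by (simp del: E2_simps(2))
    hence "f x1 = inv\<^bsub>E2\<^esub> (f ?h)"
      using h by (metis E2.inv_equality E2.inv_inv hom_closed gens(1))
    also have "\<dots> = aff (1 / (\<alpha> powi b * \<beta> powi a)) (- u / (\<alpha> powi b * \<beta> powi a))"
      unfolding u by (rule aff_inv) (simp add: norm_mult cmod_powi)
    finally show False using f_x1 by blast
  qed
  hence "aff (\<alpha> powi b * \<beta> powi a) u = aff 1 0"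
    using u assms(2) g h by (simp add: id_eq_aff del: E2_simps)
  hence eq: "\<alpha> powi b * \<beta> powi a = 1" by (simp add: aff_eq_iff)
  have ab: "b = 0 \<and> a = 0"
  proof (rule ccontr)
    assume "\<not> (b = 0 \<and> a = 0)"
    hence ne: "(b, a) \<noteq> (0, 0)" by simp
    \<comment> \<open>Encodes \<open>\<alpha> powi b * \<beta> powi a - 1\<close> as a Laurent
      polynomial with two nonzero coefficients.\<close>
    define k :: "int \<Rightarrow> int \<Rightarrow> int" where "k i j = (if (i, j) = (0, 0) then -1 else 1)" for i j
    have "(\<Sum>(i, j)\<in>{(b, a), (0, 0)}. of_int (k i j) * \<alpha> powi i * \<beta> powi j) = 0"
      using ne eq by (simp add: k_def)
    from indep[OF _ _ this, of b a] show False using ne by (simp add: k_def split: if_splits)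
  qed
  hence gn: "g = n" using g e1 N_closed(1)[OF g(2)] by simp
  hence "shift * (\<Sum>(a, b)\<in>S. of_int (c a b) * \<alpha> powi a * \<beta> powi b) = 0"
    using S(2) assms(2) by (simp add: id_eq_aff aff_eq_iff)
  hence "(\<Sum>(a, b)\<in>S. of_int (c a b) * \<alpha> powi a * \<beta> powi b) = 0"
    using shift_nonzero by simp
  hence "\<forall>(a, b)\<in>S. c a b = 0" using indep[OF S(1)] by blast
  thus ?thesis using S(3) gn by simp
qed

end

section \<open>Triangle groups\<close>

text \<open>The reflection fixes \<open>q\<close>, so \<open>q\<close> can replace \<open>p\<close>
  as base point; products of two reflections can then use a common vertex.\<close>

lemma line_reflection_eq:
  assumes "p \<noteq> q"
  shows "line_reflection p q z = q + ((q - p) / cnj (q - p)) * cnj (z - q)"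
proof -
  have "cnj q - cnj p \<noteq> 0" using assms by (simp flip: complex_cnj_diff)
  hence "q - p = ((q - p) / cnj (q - p)) * cnj (q - p)" by simp
  hence "q + ((q - p) / cnj (q - p)) * cnj (z - q)
    = p + ((q - p) / cnj (q - p)) * cnj (q - p) + ((q - p) / cnj (q - p)) * cnj (z - q)" by simp
  also have "\<dots> = p + ((q - p) / cnj (q - p)) * (cnj (q - p) + cnj (z - q))"
    by (simp only: distrib_left add.assoc)
  also have "cnj (q - p) + cnj (z - q) = cnj (z - p)" by simp
  finally show ?thesis by (simp add: line_reflection_def)
qed

text \<open>The square of the unit vector along \<open>e\<close>; it depends only on the line, not
  on its orientation.\<close>

definition axis_dir :: "complex \<Rightarrow> complex" where "axis_dir e = e / cnj e"

lemma axis_dir_unit: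
  assumes "e \<noteq> 0"
  shows "cmod (axis_dir e) = 1" "axis_dir e * cnj (axis_dir e) = 1"
proof -
  show "cmod (axis_dir e) = 1" using assms by (simp add: axis_dir_def norm_divide)
  show "axis_dir e * cnj (axis_dir e) = 1"
    using assms by (simp add: axis_dir_def)
qed

lemma axis_dir_minus: "axis_dir (p - q) = axis_dir (q - p)"
proof -
  have "axis_dir (- e) = axis_dir e" for e by (simp add: axis_dir_def)
  from this[of "q - p"] show ?thesis by simp
qed

lemma line_reflection_commute:
  assumes "p \<noteq> q"
  shows "line_reflection p q = line_reflection q p"
proof
  fix z
  have "line_reflection p q z = q + axis_dir (q - p) * cnj (z - q)"
    unfolding axis_dir_def by (rule line_reflection_eq[OF assms])
  also have "\<dots> = line_reflection q p z"
    unfolding axis_dir_minus[of q p] by (simp only: line_reflection_def axis_dir_def)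
  finally show "line_reflection p q z = line_reflection q p z" .
qed

lemma line_reflection_involution:
  assumes "p \<noteq> q"
  shows "line_reflection p q \<circ> line_reflection p q = id"
proof
  fix z
  have "(line_reflection p q \<circ> line_reflection p q) z
      = p + axis_dir (q - p) * cnj (axis_dir (q - p)) * (z - p)"
    by (simp add: line_reflection_def axis_dir_def)
  thus "(line_reflection p q \<circ> line_reflection p q) z = id z"
    using axis_dir_unit[of "q - p"] assms by simp
qed

lemma line_reflection_closed:
  assumes "p \<noteq> q"
  shows "line_reflection p q \<in> carrier E2"
proof -
  have "bij (line_reflection p q)"
    using line_reflection_involution[OF assms] by (intro o_bij[of "line_reflection p q"])
  moreover have "dist (line_reflection p q x) (line_reflection p q y) = dist x y" for x y
  proof -
    have "line_reflection p q x - line_reflection p q y = axis_dir (q - p) * cnj (x - y)"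
      by (simp add: line_reflection_def axis_dir_def algebra_simps diff_divide_distrib)
    hence "cmod (line_reflection p q x - line_reflection p q y) = cmod (x - y)"
      using axis_dir_unit(1)[of "q - p"] assms by (simp add: norm_mult del: complex_cnj_diff)
    thus ?thesis by (simp add: dist_norm)
  qed
  ultimately show ?thesis by simp
qed

lemma line_reflection_mult:
  assumes "p \<noteq> q" "q \<noteq> r"
  defines "m \<equiv> axis_dir (r - q) * cnj (axis_dir (q - p))"
  shows "line_reflection p q \<otimes>\<^bsub>E2\<^esub> line_reflection q r = aff m ((1 - m) * q)"
proof
  fix z
  have "(line_reflection p q \<otimes>\<^bsub>E2\<^esub> line_reflection q r) z
     = q + axis_dir (r - q) * cnj (axis_dir (q - p) * cnj (z - q))"
    by (simp add: line_reflection_eq[OF assms(1)] line_reflection_def[of q] axis_dir_def)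
  also have "\<dots> = aff m ((1 - m) * q) z"
    by (simp add: aff_def m_def algebra_simps)
  finally show "(line_reflection p q \<otimes>\<^bsub>E2\<^esub> line_reflection q r) z = aff m ((1 - m) * q) z" .
qed

text \<open>A reflection is antilinear up to translation: comparing the arguments 1 and
  \<open>\<i>\<close> would make its factor \<open>?u\<close> equal to its own negative.\<close>

lemma line_reflection_not_aff:
  assumes "p \<noteq> q"
  shows "line_reflection p q \<noteq> aff m v"
proof
  assume eq: "line_reflection p q = aff m v"
  let ?u = "axis_dir (q - p)"
  have *: "p + ?u * cnj (z - p) = m * z + v" for z
    using fun_cong[OF eq, of z] by (simp add: line_reflection_def axis_dir_def aff_def)
  have diff: "m * z = ?u * cnj z" for z
  proof -
    have "m * z = (m * z + v) - (m * 0 + v)" by simp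
    also have "\<dots> = (p + ?u * cnj (z - p)) - (p + ?u * cnj (0 - p))" by (simp only: *)
    also have "\<dots> = ?u * cnj z" by (simp add: algebra_simps)
    finally show ?thesis .
  qed
  have "m = ?u" using diff[of 1] by simp
  moreover have "m * \<i> = - ?u * \<i>" using diff[of "\<i>"] by simp
  hence "m = - ?u" by (metis mult_cancel_right complex_i_not_zero)
  ultimately have "?u = 0" by simp
  thus False using axis_dir_unit(1)[of "q - p"] assms by simp
qed

section \<open>Reflections in the edges of a generic triangle\<close>

locale generic_edges =
  fixes A1 A2 A3 :: complex
  assumes generic: "generic_triangle A1 A2 A3"
begin

definition "r1 = line_reflection A2 A3"
definition "r2 = line_reflection A3 A1"
definition "r3 = line_reflection A1 A2"
definition "\<alpha> = axis_dir (A3 - A2) * cnj (axis_dir (A1 - A3))"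
definition "\<beta> = axis_dir (A2 - A1) * cnj (axis_dir (A3 - A2))"

lemma distinct: "A2 \<noteq> A3" "A3 \<noteq> A1" "A1 \<noteq> A2"
proof -
  obtain k where k: "k > 0" "alg_indep3 (k * dist A2 A3) (k * dist A3 A1) (k * dist A1 A2)"
    using generic by (auto simp: generic_triangle_def)
  have "k * dist A2 A3 \<noteq> 0" "k * dist A3 A1 \<noteq> 0" "k * dist A1 A2 \<noteq> 0"
    using rat_poly3_identity[OF k(2) rat_poly3_vars(1), of 1]
      rat_poly3_identity[OF k(2) rat_poly3_vars(2), of 1]
      rat_poly3_identity[OF k(2) rat_poly3_vars(3), of 1] by auto
  thus "A2 \<noteq> A3" "A3 \<noteq> A1" "A1 \<noteq> A2" by auto
qed

lemma rotations:
  "r2 \<otimes>\<^bsub>E2\<^esub> r1 = aff \<alpha> ((1 - \<alpha>) * A3)" "r1 \<otimes>\<^bsub>E2\<^esub> r3 = aff \<beta> ((1 - \<beta>) * A2)"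
proof -
  have sym: "r1 = line_reflection A3 A2" "r2 = line_reflection A1 A3" "r3 = line_reflection A2 A1"
    unfolding r1_def r2_def r3_def using distinct by (auto intro: line_reflection_commute)
  have \<alpha>: "\<alpha> = axis_dir (A2 - A3) * cnj (axis_dir (A3 - A1))"
    and \<beta>: "\<beta> = axis_dir (A1 - A2) * cnj (axis_dir (A2 - A3))"
    by (simp_all only: \<alpha>_def \<beta>_def axis_dir_minus[of A1] axis_dir_minus[of A2 A3])
  show "r2 \<otimes>\<^bsub>E2\<^esub> r1 = aff \<alpha> ((1 - \<alpha>) * A3)" unfolding sym \<alpha>
    by (rule line_reflection_mult) (use distinct in auto)
  show "r1 \<otimes>\<^bsub>E2\<^esub> r3 = aff \<beta> ((1 - \<beta>) * A2)" unfolding sym \<beta>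
    by (rule line_reflection_mult) (use distinct in auto)
qed

lemma unit_parts: "cmod \<alpha> = 1" "cmod \<beta> = 1"
  using distinct by (simp_all add: \<alpha>_def \<beta>_def norm_mult axis_dir_unit)

text \<open>The law of cosines brings the multipliers into the form treated in
  \<open>generic_laurent_independent\<close>: doubling \<open>e1 * cnj e2\<close> and
  \<open>e3 * cnj e1\<close> gives the two real differences of squares plus the same
  \<open>w\<close>.\<close>

lemma independent:
  fixes k :: "int \<Rightarrow> int \<Rightarrow> int"
  assumes "finite S" "(a, b) \<in> S"
    and zero: "(\<Sum>(a, b)\<in>S. of_int (k a b) * \<alpha> powi a * \<beta> powi b) = 0"
  shows "k a b = 0"
proof -
  obtain l where l: "l > 0" "alg_indep3 (l * dist A2 A3) (l * dist A3 A1) (l * dist A1 A2)"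
    using generic by (auto simp: generic_triangle_def)
  define e1 where "e1 = of_real l * (A3 - A2)"
  define e2 where "e2 = of_real l * (A1 - A3)"
  define e3 where "e3 = of_real l * (A2 - A1)"
  have e3: "e3 = - e1 - e2" by (simp add: e1_def e2_def e3_def algebra_simps)
  define x y z where "x = l * dist A2 A3" and "y = l * dist A3 A1" and "z = l * dist A1 A2"
  have "x = cmod e1" "y = cmod e2" "z = cmod e3"
    using l by (simp_all add: x_def y_def z_def e1_def e2_def e3_def norm_mult dist_norm norm_minus_commute)
  hence sq: "complex_of_real (x\<^sup>2) = e1 * cnj e1" "complex_of_real (y\<^sup>2) = e2 * cnj e2"
    "complex_of_real (z\<^sup>2) = e3 * cnj e3"
    by (simp_all only: complex_norm_square)
  \<comment> \<open>Up to sign, \<open>\<i>\<close> times four times the area of the rescaled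
    triangle.\<close>
  define w where "w = e1 * cnj e2 - cnj e1 * e2"
  have c: "complex_of_real (z\<^sup>2 - x\<^sup>2 - y\<^sup>2) = e1 * cnj e2 + cnj e1 * e2"
    and d: "complex_of_real (y\<^sup>2 - x\<^sup>2 - z\<^sup>2) = 2 * e3 * cnj e1 - w"
    unfolding of_real_diff sq w_def by (simp_all add: e3 algebra_simps)
  have "complex_of_real (heron x y z) = (e1 * cnj e2 + cnj e1 * e2)\<^sup>2 - 4 * (e1 * cnj e1) * (e2 * cnj e2)"
    unfolding heron_def of_real_diff[of "(_)\<^sup>2"] of_real_power[of "z\<^sup>2 - x\<^sup>2 - y\<^sup>2"] c of_real_mult sq by simp
  hence w2: "w\<^sup>2 = of_real (heron x y z)"
    by (simp add: w_def power2_eq_square algebra_simps)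
  have Re: "Re w = 0" by (simp add: w_def)
  have dir: "axis_dir (of_real l * u) = axis_dir u" for u
    using l by (simp add: axis_dir_def)
  have "\<alpha> = axis_dir e1 * cnj (axis_dir e2)" "\<beta> = axis_dir e3 * cnj (axis_dir e1)"
    unfolding \<alpha>_def \<beta>_def e1_def e2_def e3_def dir by simp_all
  moreover have "complex_of_real (z\<^sup>2 - x\<^sup>2 - y\<^sup>2) + w = 2 * (e1 * cnj e2)"
    "complex_of_real (z\<^sup>2 - x\<^sup>2 - y\<^sup>2) - w = 2 * (cnj e1 * e2)"
    "complex_of_real (y\<^sup>2 - x\<^sup>2 - z\<^sup>2) + w = 2 * (e3 * cnj e1)"
    "complex_of_real (y\<^sup>2 - x\<^sup>2 - z\<^sup>2) - w = 2 * (cnj e3 * e1)"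
    unfolding c d w_def by (simp_all add: e3 algebra_simps)
  ultimately have frac: "\<alpha> = (complex_of_real (z\<^sup>2 - x\<^sup>2 - y\<^sup>2) + w) / (complex_of_real (z\<^sup>2 - x\<^sup>2 - y\<^sup>2) - w)"
    "\<beta> = (complex_of_real (y\<^sup>2 - x\<^sup>2 - z\<^sup>2) + w) / (complex_of_real (y\<^sup>2 - x\<^sup>2 - z\<^sup>2) - w)"
    by (simp_all add: axis_dir_def del: of_real_diff)
  show ?thesis
    by (rule generic_laurent_independent[OF l(2)[folded x_def y_def z_def] w2 Re assms(1,2)])
      (use zero in \<open>simp only: frac\<close>)
qed

text \<open>Equality with 1 would be a relation with just two terms.\<close>

lemma parts_ne_1: "\<alpha> \<noteq> 1" "\<beta> \<noteq> 1"
proof -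
  define k :: "int \<Rightarrow> int \<Rightarrow> int" where "k i j = (if (i, j) = (0, 0) then -1 else 1)" for i j
  show "\<alpha> \<noteq> 1"
    using independent[of "{(1, 0), (0, 0)}" 0 0 k] by (auto simp: k_def)
  show "\<beta> \<noteq> 1"
    using independent[of "{(0, 1), (0, 0)}" 0 0 k] by (auto simp: k_def)
qed

lemma r_closed: "r1 \<in> carrier E2" "r2 \<in> carrier E2" "r3 \<in> carrier E2"
  unfolding r1_def r2_def r3_def by (rule line_reflection_closed, rule distinct)+

text \<open>The commutator of two rotations is a translation, so are its conjugates, and
  translations commute.\<close>

lemma r_relators: "satisfies_relators E2 r1 r2 r3"
proof -
  have "r1 \<otimes>\<^bsub>E2\<^esub> r1 = \<one>\<^bsub>E2\<^esub>" "r2 \<otimes>\<^bsub>E2\<^esub> r2 = \<one>\<^bsub>E2\<^esub>" "r3 \<otimes>\<^bsub>E2\<^esub> r3 = \<one>\<^bsub>E2\<^esub>"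
    unfolding r1_def r2_def r3_def using distinct by (simp_all add: line_reflection_involution)
  moreover obtain v where v: "rel_v E2 r1 r2 r3 = aff 1 v"
    unfolding rel_v_def rotations using aff_commutator[OF unit_parts] by blast
  moreover have "commutator E2 (aff 1 v)
      (inv\<^bsub>E2\<^esub> rel_h E2 r1 r2 r3 n m \<otimes>\<^bsub>E2\<^esub> aff 1 v \<otimes>\<^bsub>E2\<^esub> rel_h E2 r1 r2 r3 n m) = \<one>\<^bsub>E2\<^esub>"
    for n m :: int
  proof -
    obtain u u' where "(r2 \<otimes>\<^bsub>E2\<^esub> r1) [^]\<^bsub>E2\<^esub> n = aff (\<alpha> powi n) u" "(r1 \<otimes>\<^bsub>E2\<^esub> r3) [^]\<^bsub>E2\<^esub> m = aff (\<beta> powi m) u'"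
      unfolding rotations using aff_pow unit_parts by blast
    then obtain \<mu> u'' where h: "rel_h E2 r1 r2 r3 n m = aff \<mu> u''" "\<mu> = \<alpha> powi n * \<beta> powi m"
      unfolding rel_h_def by (auto simp only: aff_mult aff_eq_iff)
    have unit: "cmod \<mu> = 1"
      by (simp add: h norm_mult norm_power_int unit_parts)
    hence "\<mu> \<noteq> 0" by auto
    thus ?thesis unfolding h(1) aff_inv[OF unit] aff_mult
      by (simp add: translations_commutator del: E2_simps)
  qed
  ultimately show ?thesis unfolding satisfies_relators_def v by blast
qed

text \<open>The pairs satisfy the relators in the product group, and its first projection is an
  affine representation to which \<open>f_injective\<close> applies. This is single-valuedness over
  the identity.\<close>

lemma presentation_injective:
  assumes "group H" and a: "a1 \<in> carrier H" "a2 \<in> carrier H" "a3 \<in> carrier H"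
    and rel: "satisfies_relators H a1 a2 a3"
    and g: "(id, h) \<in> generate (E2 \<times>\<times> H) {(r1, a1), (r2, a2), (r3, a3)}"
  shows "h = \<one>\<^bsub>H\<^esub>"
proof -
  interpret H: group H by (rule assms(1))
  interpret K: group "E2 \<times>\<times> H" by (rule DirProd_group[OF E2_group assms(1)])
  interpret hom: group_hom "E2 \<times>\<times> H" E2 fst by (rule fst_group_hom[OF E2_group assms(1)])
  interpret R: relator_group "E2 \<times>\<times> H" "(r1, a1)" "(r2, a2)" "(r3, a3)"
    by unfold_locales
      (use r_closed a satisfies_relators_DirProd[OF E2_group assms(1) r_relators rel] in
        \<open>simp_all del: E2_simps\<close>)
  have PQ: "fst R.P = aff \<alpha> ((1 - \<alpha>) * A3)" "fst R.Q = aff \<beta> ((1 - \<beta>) * A2)"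
    using rotations by (simp_all add: R.P_def R.Q_def)
  \<comment> \<open>The factors are nonzero because both rotations are nontrivial and their centres
    \<open>A3\<close> and \<open>A2\<close> differ.\<close>
  have "\<beta> * ((1 - \<alpha>) * A3) + (1 - \<beta>) * A2 - (1 - \<alpha>) * A3 - \<alpha> * ((1 - \<beta>) * A2)
      = (1 - \<alpha>) * (1 - \<beta>) * (A2 - A3)"
    by (simp add: algebra_simps)
  moreover have "\<dots> \<noteq> 0" using parts_ne_1 distinct by simp
  ultimately have nz: "\<beta> * ((1 - \<alpha>) * A3) + (1 - \<beta>) * A2 - (1 - \<alpha>) * A3 - \<alpha> * ((1 - \<beta>) * A2) \<noteq> 0"
    by simp
  interpret affine_relator_group "E2 \<times>\<times> H" "(r1, a1)" "(r2, a2)" "(r3, a3)" fst \<alpha> \<beta>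
    "(1 - \<alpha>) * A3" "(1 - \<beta>) * A2"
    by unfold_locales
      (use PQ nz unit_parts independent line_reflection_not_aff[OF distinct(1)] in
        \<open>simp_all add: r1_def del: E2_simps\<close>)
  show ?thesis using f_injective[OF g] by simp
qed

lemma triangle_group_eq: "triangle_group A1 A2 A3 = E2\<lparr>carrier := generate E2 {r1, r2, r3}\<rparr>"
  by (simp add: triangle_group_def r1_def r2_def r3_def)

text \<open>The subgroup \<open>S\<close> generated by the pairs is a graph: quotients of pairs over
  the same \<open>g\<close> reduce uniqueness to \<open>presentation_injective\<close>, and the
  first projection maps \<open>S\<close> onto the triangle group.\<close>

lemma universal_property:
  assumes "group H" and a: "a1 \<in> carrier H" "a2 \<in> carrier H" "a3 \<in> carrier H"
    and rel: "satisfies_relators H a1 a2 a3"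
  shows "\<exists>\<phi>\<in>hom (triangle_group A1 A2 A3) H. \<phi> r1 = a1 \<and> \<phi> r2 = a2 \<and> \<phi> r3 = a3"
proof -
  interpret H: group H by (rule assms(1))
  interpret K: group "E2 \<times>\<times> H" by (rule DirProd_group[OF E2_group assms(1)])
  interpret hom: group_hom "E2 \<times>\<times> H" E2 fst by (rule fst_group_hom[OF E2_group assms(1)])
  let ?X = "{(r1, a1), (r2, a2), (r3, a3)}"
  define S where "S = generate (E2 \<times>\<times> H) ?X"
  have X: "?X \<subseteq> carrier (E2 \<times>\<times> H)" using a r_closed by (simp del: E2_simps)
  have S: "subgroup S (E2 \<times>\<times> H)" unfolding S_def by (rule K.generate_is_subgroup[OF X])
  have S_carr: "h \<in> carrier H" if "(g, h) \<in> S" for g h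
    using subgroup.mem_carrier[OF S that] by simp
  have unique: "h = h'" if "(g, h) \<in> S" "(g, h') \<in> S" for g h h'
  proof -
    have g: "g \<in> carrier E2" using subgroup.mem_carrier[OF S that(1)] by (simp del: E2_simps)
    have "(g, h) \<otimes>\<^bsub>E2 \<times>\<times> H\<^esub> inv\<^bsub>E2 \<times>\<times> H\<^esub> (g, h') \<in> S"
      using that by (intro subgroup.m_closed[OF S] subgroup.m_inv_closed[OF S])
    moreover have "inv\<^bsub>E2 \<times>\<times> H\<^esub> (g, h') = (inv\<^bsub>E2\<^esub> g, inv\<^bsub>H\<^esub> h')"
      using g S_carr[OF that(2)] E2_group assms(1) by (intro inv_DirProd)
    ultimately have "(id, h \<otimes>\<^bsub>H\<^esub> inv\<^bsub>H\<^esub> h') \<in> S"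
      using E2.r_inv[OF g] by simp
    hence "h \<otimes>\<^bsub>H\<^esub> inv\<^bsub>H\<^esub> h' = \<one>\<^bsub>H\<^esub>"
      unfolding S_def by (rule presentation_injective[OF assms])
    thus ?thesis using S_carr that by (metis H.inv_closed H.inv_equality H.inv_inv)
  qed
  have "generate E2 {r1, r2, r3} = fst ` S"
    using hom.generate_img[OF X] by (simp add: S_def)
  hence exists: "\<exists>h. (g, h) \<in> S" if "g \<in> generate E2 {r1, r2, r3}" for g
    using that by auto
  define \<phi> where "\<phi> g = (THE h. (g, h) \<in> S)" for g
  have \<phi>_eq: "\<phi> g = h" if "(g, h) \<in> S" for g h
    unfolding \<phi>_def using that unique by blast
  have \<phi>_mem: "(g, \<phi> g) \<in> S" if "g \<in> generate E2 {r1, r2, r3}" for g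
    using exists[OF that] \<phi>_eq by auto
  have "\<phi> \<in> hom (triangle_group A1 A2 A3) H"
  proof (rule homI)
    fix g assume "g \<in> carrier (triangle_group A1 A2 A3)"
    thus "\<phi> g \<in> carrier H" using \<phi>_mem S_carr by (auto simp: triangle_group_eq)
  next
    fix g g' assume "g \<in> carrier (triangle_group A1 A2 A3)" "g' \<in> carrier (triangle_group A1 A2 A3)"
    hence "(g, \<phi> g) \<otimes>\<^bsub>E2 \<times>\<times> H\<^esub> (g', \<phi> g') \<in> S"
      by (intro subgroup.m_closed[OF S] \<phi>_mem) (simp_all add: triangle_group_eq)
    thus "\<phi> (g \<otimes>\<^bsub>triangle_group A1 A2 A3\<^esub> g') = \<phi> g \<otimes>\<^bsub>H\<^esub> \<phi> g'"
      by (intro \<phi>_eq) (simp add: triangle_group_eq)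
  qed
  moreover have "(r1, a1) \<in> S" "(r2, a2) \<in> S" "(r3, a3) \<in> S"
    unfolding S_def by (auto intro: generate.incl)
  ultimately show ?thesis using \<phi>_eq by blast
qed

end

text \<open>The presentation is expressed by its universal property. The map is unique because the
  reflections generate; applied to a copy of the presented group, it inverts the canonical
  surjection.\<close>

theorem theorem5p3:
  fixes A1 A2 A3 :: complex
  assumes "generic_triangle A1 A2 A3"
  shows "group (triangle_group A1 A2 A3)
    \<and> satisfies_relators (triangle_group A1 A2 A3)
         (line_reflection A2 A3) (line_reflection A3 A1) (line_reflection A1 A2)
    \<and> (\<forall>(H :: 'h monoid) a1 a2 a3.
          group H \<and> a1 \<in> carrier H \<and> a2 \<in> carrier H \<and> a3 \<in> carrier H
          \<and> satisfies_relators H a1 a2 a3 \<longrightarrow>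
          (\<exists>\<phi> \<in> hom (triangle_group A1 A2 A3) H.
             \<phi> (line_reflection A2 A3) = a1 \<and> \<phi> (line_reflection A3 A1) = a2
             \<and> \<phi> (line_reflection A1 A2) = a3))"
proof -
  interpret generic_edges A1 A2 A3 by unfold_locales (rule assms)
  have sub: "subgroup (generate E2 {r1, r2, r3}) E2"
    by (rule E2.generate_is_subgroup) (use r_closed in blast)
  have "group (triangle_group A1 A2 A3)"
    unfolding triangle_group_eq by (rule E2.subgroup_imp_group[OF sub])
  moreover have "satisfies_relators (triangle_group A1 A2 A3) r1 r2 r3"
    unfolding triangle_group_eq
    by (rule E2.satisfies_relators_subgroup[OF sub _ _ _ r_relators]) (auto intro: generate.incl)
  ultimately show ?thesis
    unfolding r1_def r2_def r3_def
    using universal_property[unfolded r1_def r2_def r3_def] by auto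
qed

end
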